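(* Let $\Gamma$ be a distance-regular graph with classical parameters $(D,b,\alpha,\beta)$ such that $b\ge 2$ and $D\ge 3$. Let $s$ be a positive integer and assume $\Gamma$ has the SPLS$(s)$ property. Let $r=[D]$. Assume that (1) $\beta > (b+2)(b+1)(s-1) - (b(b+1)+r-1)\alpha$; (2) $\beta > ((b+1)(b^2+b+1)-2)(s-b) - \alpha(b+1)r + \alpha(b+1)^2$; (3) $\beta > ((b+1)(b^2+b+1)-2+b)(s-b) - \alpha(r-1) + b^2 - b$. Then $\Gamma$ is geometric.
   Context: Distance-regular graph with intersection numbers $b_i,c_i$, valency $k=b_0$, $a_i=k-b_i-c_i$. For integer $b\ne 1$, $[j]=\frac{b^j-1}{b-1}$. Classical parameters $(D,b,\alpha,\beta)$: diameter $D$, $b_i=([D]-[i])(\beta-\alpha[i])$ ($0\le i\le D-1$), $c_i=[i](1+\alpha[i-1])$ ($1\le i\le D$). A partial linear space: points and lines, any two distinct points on at most one common line; point graph: points adjacent iff on a common line. $\tau(X)$: maximum over non-incident point $x$ and line $\ell$ of the number of points of $\ell$ collinear with $x$. For integers $c\ge1,s\ge2$, $\Gamma$ has the SPLS$(c,s)$ property if $\Gamma$ is the point graph of a partial linear space $X=(V(\Gamma),\mathcal L,\in)$ with $\mathcal L$ the set of all maximal cliques with at least $a_1+2-(c-1)(s-1)$ vertices, $a_1\ge(2s-1)(c-1)$, each vertex on at most $s$ lines, and $\tau(X)\le c$; SPLS$(s)$ means SPLS$(c_2,s)$. With $\theta_{\min}$ the smallest adjacency eigenvalue, a Delsarte clique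 is a clique of size $1+\frac{k}{-\theta_{\min}}$; $\Gamma$ is geometric if there is a set of Delsarte cliques such that every edge lies in exactly one of them. *)

theory Defs
  imports Complex_Main
begin

section \<open>Finite simple graphs given by a vertex set and an adjacency relation\<close>

definition simple_graph :: "'a set \<Rightarrow> ('a \<Rightarrow> 'a \<Rightarrow> bool) \<Rightarrow> bool" where
  "simple_graph V E \<longleftrightarrow> finite V \<and> V \<noteq> {} \<and>
     (\<forall>x y. E x y \<longrightarrow> x \<in> V \<and> y \<in> V) \<and>
     (\<forall>x y. E x y \<longrightarrow> E y x) \<and> (\<forall>x. \<not> E x x)"

definition edge_rel :: "'a set \<Rightarrow> ('a \<Rightarrow> 'a \<Rightarrow> bool) \<Rightarrow> ('a \<times> 'a) set" where
  "edge_rel V E = {(x, y). x \<in> V \<and> y \<in> V \<and> E x y}"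

text \<open>Path-length distance: least number of edges of a walk from x to y.\<close>
definition gdist :: "'a set \<Rightarrow> ('a \<Rightarrow> 'a \<Rightarrow> bool) \<Rightarrow> 'a \<Rightarrow> 'a \<Rightarrow> nat" where
  "gdist V E x y = (LEAST n. (x, y) \<in> (edge_rel V E) ^^ n)"

definition connected_graph :: "'a set \<Rightarrow> ('a \<Rightarrow> 'a \<Rightarrow> bool) \<Rightarrow> bool" where
  "connected_graph V E \<longleftrightarrow> (\<forall>x\<in>V. \<forall>y\<in>V. (x, y) \<in> (edge_rel V E)\<^sup>*)"

definition diameter :: "'a set \<Rightarrow> ('a \<Rightarrow> 'a \<Rightarrow> bool) \<Rightarrow> nat" where
  "diameter V E = Max {gdist V E x y | x y. x \<in> V \<and> y \<in> V}"

text \<open>Distance-regular graph of diameter D with intersection numbers b_i (bs) and c_i (cs):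
  for all x, y at distance i, y has exactly c_i neighbours at distance i-1 from x (1 \<le> i \<le> D)
  and exactly b_i neighbours at distance i+1 from x (0 \<le> i \<le> D-1).\<close>
definition distance_regular ::
  "'a set \<Rightarrow> ('a \<Rightarrow> 'a \<Rightarrow> bool) \<Rightarrow> nat \<Rightarrow> (nat \<Rightarrow> nat) \<Rightarrow> (nat \<Rightarrow> nat) \<Rightarrow> bool" where
  "distance_regular V E D bs cs \<longleftrightarrow>
     simple_graph V E \<and> connected_graph V E \<and> diameter V E = D \<and>
     (\<forall>x\<in>V. \<forall>y\<in>V. \<forall>i. gdist V E x y = i \<longrightarrow>
        (1 \<le> i \<and> i \<le> D \<longrightarrow> card {z\<in>V. gdist V E x z = i - 1 \<and> E y z} = cs i) \<and>
        (i + 1 \<le> D \<longrightarrow> card {z\<in>V. gdist V E x z = i + 1 \<and> E y z} = bs i))"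

section \<open>Classical parameters\<close>

text \<open>Gaussian-type number [j] = (b^j - 1)/(b - 1).\<close>
definition qnum :: "int \<Rightarrow> nat \<Rightarrow> real" where
  "qnum b j = (real_of_int b ^ j - 1) / (real_of_int b - 1)"

definition classical_parameters ::
  "nat \<Rightarrow> (nat \<Rightarrow> nat) \<Rightarrow> (nat \<Rightarrow> nat) \<Rightarrow> int \<Rightarrow> real \<Rightarrow> real \<Rightarrow> bool" where
  "classical_parameters D bs cs b \<alpha> \<beta> \<longleftrightarrow> b \<noteq> 1 \<and>
     (\<forall>i. i \<le> D - 1 \<longrightarrow> real (bs i) = (qnum b D - qnum b i) * (\<beta> - \<alpha> * qnum b i)) \<and>
     (\<forall>i. 1 \<le> i \<and> i \<le> D \<longrightarrow> real (cs i) = qnum b i * (1 + \<alpha> * qnum b (i - 1)))"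

section \<open>The SPLS property\<close>

definition is_clique :: "'a set \<Rightarrow> ('a \<Rightarrow> 'a \<Rightarrow> bool) \<Rightarrow> 'a set \<Rightarrow> bool" where
  "is_clique V E C \<longleftrightarrow> C \<subseteq> V \<and> (\<forall>x\<in>C. \<forall>y\<in>C. x \<noteq> y \<longrightarrow> E x y)"

definition maximal_clique :: "'a set \<Rightarrow> ('a \<Rightarrow> 'a \<Rightarrow> bool) \<Rightarrow> 'a set \<Rightarrow> bool" where
  "maximal_clique V E C \<longleftrightarrow> is_clique V E C \<and> (\<forall>C'. is_clique V E C' \<and> C \<subseteq> C' \<longrightarrow> C' = C)"

text \<open>Lines: maximal cliques with at least a_1 + 2 - (c-1)(s-1) vertices.\<close>
definition spls_lines :: "'a set \<Rightarrow> ('a \<Rightarrow> 'a \<Rightarrow> bool) \<Rightarrow> int \<Rightarrow> nat \<Rightarrow> nat \<Rightarrow> 'a set set" where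
  "spls_lines V E a1 c s = {C. maximal_clique V E C \<and>
      int (card C) \<ge> a1 + 2 - (int c - 1) * (int s - 1)}"

text \<open>SPLS(c,s) for a graph with a_1 = a1.\<close>
definition SPLS :: "'a set \<Rightarrow> ('a \<Rightarrow> 'a \<Rightarrow> bool) \<Rightarrow> int \<Rightarrow> nat \<Rightarrow> nat \<Rightarrow> bool" where
  "SPLS V E a1 c s \<longleftrightarrow> (let L = spls_lines V E a1 c s in
     c \<ge> 1 \<and> s \<ge> 2 \<and>
     \<comment> \<open>partial linear space: two distinct points lie on at most one common line\<close>
     (\<forall>x\<in>V. \<forall>y\<in>V. x \<noteq> y \<longrightarrow> card {l\<in>L. x \<in> l \<and> y \<in> l} \<le> 1) \<and>
     \<comment> \<open>the graph is its point graph\<close>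
     (\<forall>x\<in>V. \<forall>y\<in>V. E x y \<longleftrightarrow> x \<noteq> y \<and> (\<exists>l\<in>L. x \<in> l \<and> y \<in> l)) \<and>
     a1 \<ge> (2 * int s - 1) * (int c - 1) \<and>
     (\<forall>x\<in>V. card {l\<in>L. x \<in> l} \<le> s) \<and>
     \<comment> \<open>tau(X) \<le> c\<close>
     (\<forall>x\<in>V. \<forall>l\<in>L. x \<notin> l \<longrightarrow> card {y\<in>l. E x y} \<le> c))"

section \<open>Eigenvalues, Delsarte cliques, geometric graphs\<close>

definition adj_eigenvalue :: "'a set \<Rightarrow> ('a \<Rightarrow> 'a \<Rightarrow> bool) \<Rightarrow> real \<Rightarrow> bool" where
  "adj_eigenvalue V E \<theta> \<longleftrightarrow> (\<exists>f :: 'a \<Rightarrow> real. (\<exists>x\<in>V. f x \<noteq> 0) \<and>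
      (\<forall>x\<in>V. (\<Sum>y\<in>{y\<in>V. E x y}. f y) = \<theta> * f x))"

definition theta_min :: "'a set \<Rightarrow> ('a \<Rightarrow> 'a \<Rightarrow> bool) \<Rightarrow> real" where
  "theta_min V E = Min {\<theta>. adj_eigenvalue V E \<theta>}"

definition delsarte_clique :: "'a set \<Rightarrow> ('a \<Rightarrow> 'a \<Rightarrow> bool) \<Rightarrow> nat \<Rightarrow> 'a set \<Rightarrow> bool" where
  "delsarte_clique V E k C \<longleftrightarrow> is_clique V E C \<and>
      real (card C) = 1 + real k / (- theta_min V E)"

text \<open>Geometric (for a regular graph of valency k).\<close>
definition geometric :: "'a set \<Rightarrow> ('a \<Rightarrow> 'a \<Rightarrow> bool) \<Rightarrow> nat \<Rightarrow> bool" where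
  "geometric V E k \<longleftrightarrow> (\<exists>\<C>. (\<forall>C\<in>\<C>. delsarte_clique V E k C) \<and>
      (\<forall>x\<in>V. \<forall>y\<in>V. E x y \<longrightarrow> (\<exists>!C. C \<in> \<C> \<and> x \<in> C \<and> y \<in> C)))"

end

theory Submission
  imports Defs "HOL-Computational_Algebra.Polynomial"
begin

text \<open>
  Write \<open>r\<close> for the Gaussian number \<open>[D]\<close>, so that \<open>-r\<close> is an eigenvalue and Delsarte's argument
  bounds every clique by \<open>1 + \<beta>\<close>; hence every vertex is on at least \<open>r\<close> lines. The point is to show
  that it is on exactly \<open>r\<close> lines, for then all lines have \<open>1 + \<beta>\<close> points and \<open>A + r I\<close> is the
  positive semidefinite matrix of a sum of squares over the lines, so \<open>-r\<close> is the smallest eigenvalue.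

  Hypothesis (1) forces \<open>\<tau> \<le> b + 1\<close>, and (2) and (3) then force that for \<open>d(x, y) = 2\<close> exactly
  \<open>b + 1\<close> lines on \<open>x\<close> lie entirely within distance two of \<open>y\<close>. These sets of lines, as \<open>y\<close> varies,
  are the blocks of a linear space on the lines through \<open>x\<close>. The lines on \<open>x\<close> that lie within distance
  three of a vertex \<open>w\<close> with \<open>d(x, w) = 3\<close> number at most \<open>[3]\<close>, and they serve as planes; so the
  linear space has the Veblen property and is a projective space of order \<open>b\<close>. Its number of points
  is therefore a Gaussian number, and the sizes of the lines leave only \<open>[D]\<close>.
\<close>

section \<open>Distances and intersection numbers\<close>

text \<open>Write \<open>q\<close> for b. Counting points on lines only places the number of lines
  on a vertex between \<open>[D]\<close> and \<open>[D+1] - 1\<close>; the geometry is there to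
  exclude the values in between. Exact numbers come from a gap: a line with a point at distance
  three from \<open>x\<close> has at most \<open>q^3 + q^2 + 2q\<close> points within distance two
  of \<open>x\<close>, by \<alpha> \<le> q, whereas each line has more than
  \<open>(q^3 + 2q^2 + 2q - 1)(s - q) + 1\<close> points. The main obstacle is that a block on
  \<open>x\<close> is defined through a vertex \<open>y\<close>, so two blocks sharing two lines
  must be shown to coincide, and nothing at \<open>x\<close> compares them. The base vertex is moved
  along one shared line to a vertex \<open>z\<close> adjacent to none of a bounded set of vertices;
  there both blocks become the set of lines on \<open>z\<close> close to the other shared line. The
  planes have a defect too: closure under joining is available only for joins with a line that has a
  point at distance two from \<open>w\<close>, so \<open>w\<close> has to be chosen to suit the
  lines in Veblen's axiom.\<close>

lemma sym_relpow: "sym R \<Longrightarrow> sym (R ^^ n)"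
proof (induction n)
  case (Suc n)
  then have "(y, x) \<in> R ^^ Suc n" if "(x, y) \<in> R ^^ Suc n" for x y
    using that by (metis relpow_Suc_D2 relpow_Suc_I symD)
  then show ?case by (blast intro: symI)
qed (auto simp: sym_def)

locale drg_graph =
  fixes V :: "'a set" and E :: "'a \<Rightarrow> 'a \<Rightarrow> bool" and D :: nat and bs cs :: "nat \<Rightarrow> nat"
  assumes drg: "distance_regular V E D bs cs"
begin

abbreviation d :: "'a \<Rightarrow> 'a \<Rightarrow> nat" where "d \<equiv> gdist V E"

lemma finV [simp]: "finite V" and V_ne: "V \<noteq> {}"
  and E_V: "E x y \<Longrightarrow> x \<in> V" "E x y \<Longrightarrow> y \<in> V"
  and E_sym: "E x y \<Longrightarrow> E y x" and E_irr [simp]: "\<not> E x x"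
  using drg unfolding distance_regular_def simple_graph_def by blast+

lemma E_commute: "E x y \<longleftrightarrow> E y x"
  using E_sym by blast

lemma sym_edge: "sym (edge_rel V E)"
  by (auto simp: sym_def edge_rel_def E_sym)

lemma d_relpow: assumes "x \<in> V" "y \<in> V" shows "(x, y) \<in> edge_rel V E ^^ d x y"
proof -
  have "(x, y) \<in> (edge_rel V E)\<^sup>*"
    using drg assms unfolding distance_regular_def connected_graph_def by blast
  then obtain n where "(x, y) \<in> edge_rel V E ^^ n"
    using rtrancl_imp_UN_relpow by blast
  then show ?thesis unfolding gdist_def by (rule LeastI)
qed

lemma d_le: "(x, y) \<in> edge_rel V E ^^ n \<Longrightarrow> d x y \<le> n"
  unfolding gdist_def by (rule Least_le)

lemma d_sym: assumes "x \<in> V" "y \<in> V" shows "d x y = d y x"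
  using d_relpow[of x y] d_relpow[of y x] assms sym_relpow[OF sym_edge]
  by (meson d_le le_antisym symD)

lemma d_tri: assumes "x \<in> V" "y \<in> V" "z \<in> V" shows "d x z \<le> d x y + d y z"
  using d_relpow[of x y] d_relpow[of y z] assms by (auto simp: relpow_add intro!: d_le)

lemma d_refl [simp]: "d x x = 0"
  using d_le[of x x 0] by simp

lemma d_0: "x \<in> V \<Longrightarrow> y \<in> V \<Longrightarrow> d x y = 0 \<longleftrightarrow> x = y"
  using d_relpow[of x y] by auto

lemma d_1: assumes "x \<in> V" "y \<in> V" shows "d x y = Suc 0 \<longleftrightarrow> E x y"
proof
  assume "d x y = Suc 0"
  then show "E x y" using d_relpow[OF assms] by (auto simp: edge_rel_def)
next
  assume e: "E x y"
  then have "d x y \<le> 1" using assms by (intro d_le) (auto simp: edge_rel_def)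
  moreover have "d x y \<noteq> 0" using e d_0 assms by auto
  ultimately show "d x y = Suc 0" by simp
qed

lemma d_E: "E x y \<Longrightarrow> d x y = Suc 0"
  using d_1 E_V by blast

lemma d_tri_E: assumes "E y z" "x \<in> V" shows "d x z \<le> Suc (d x y)"
  using d_tri[of x y z] assms E_V d_E by fastforce

lemma d_tri_E': assumes "E x y" "z \<in> V" shows "d x z \<le> Suc (d y z)"
  using d_tri[of x y z] assms E_V d_E by fastforce

lemma d_step: assumes "x \<in> V" "y \<in> V" "d x y = Suc n"
  obtains z where "z \<in> V" "d x z = n" "E z y"
proof -
  have "(x, y) \<in> edge_rel V E ^^ Suc n" using d_relpow assms by metis
  then obtain z where z: "(x, z) \<in> edge_rel V E ^^ n" "(z, y) \<in> edge_rel V E" by auto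
  then have "E z y" "z \<in> V" by (auto simp: edge_rel_def)
  moreover have "d x z \<le> n" using z d_le by blast
  moreover have "d x y \<le> Suc (d x z)" using d_tri_E[OF \<open>E z y\<close>] assms by blast
  ultimately show ?thesis using that assms(3) by (metis Suc_le_mono le_antisym)
qed

lemma d_set: "{d x y | x y. x \<in> V \<and> y \<in> V} = (\<lambda>(x, y). d x y) ` (V \<times> V)"
  by auto

lemma d_le_D: "x \<in> V \<Longrightarrow> y \<in> V \<Longrightarrow> d x y \<le> D"
proof -
  assume "x \<in> V" "y \<in> V"
  then have "d x y \<le> Max ((\<lambda>(x, y). d x y) ` (V \<times> V))" by (intro Max_ge) auto
  then show ?thesis using drg unfolding distance_regular_def diameter_def d_set by simp
qed

lemma D_attained: obtains x y where "x \<in> V" "y \<in> V" "d x y = D"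
proof -
  have "Max ((\<lambda>(x, y). d x y) ` (V \<times> V)) \<in> (\<lambda>(x, y). d x y) ` (V \<times> V)"
    using V_ne by (intro Max_in) auto
  then show ?thesis using drg that unfolding distance_regular_def diameter_def d_set by auto
qed

text \<open>Walking back along a geodesic from a pair at distance \<open>D\<close>. Each
  intersection number is thereby realised by an actual pair, which gives positivity.\<close>

lemma d_attained: assumes "i \<le> D" obtains x y where "x \<in> V" "y \<in> V" "d x y = i"
proof -
  obtain x y where xy: "x \<in> V" "y \<in> V" "d x y = D" using D_attained by blast
  have "\<exists>z\<in>V. d x z = D - j" if "j \<le> D" for j
    using that
  proof (induction j)
    case 0
    then show ?case using xy by auto
  next
    case (Suc j)
    then obtain z where "z \<in> V" "d x z = Suc (D - Suc j)" by (auto simp: Suc_diff_Suc)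
    then show ?case using d_step xy(1) by metis
  qed
  from this[of "D - i"] show ?thesis using that assms xy(1) by auto
qed

lemma card_c: assumes "x \<in> V" "y \<in> V" "d x y = Suc i"
  shows "card {z. E y z \<and> d x z = i} = cs (Suc i)"
proof -
  have "{z. E y z \<and> d x z = i} = {z\<in>V. d x z = Suc i - 1 \<and> E y z}" using E_V by auto
  moreover have "card {z\<in>V. d x z = d x y - 1 \<and> E y z} = cs (d x y)"
  proof -
    have "1 \<le> d x y" using assms(3) by simp
    then show ?thesis using drg assms(1,2) d_le_D[OF assms(1,2)]
      unfolding distance_regular_def by blast
  qed
  ultimately show ?thesis using assms(3) by simp
qed

lemma card_b: assumes "x \<in> V" "y \<in> V" "d x y = i" "i < D"
  shows "card {z. E y z \<and> d x z = Suc i} = bs i"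
proof -
  have "{z. E y z \<and> d x z = Suc i} = {z\<in>V. d x z = i + 1 \<and> E y z}" using E_V by auto
  then show ?thesis using drg assms unfolding distance_regular_def by auto
qed

lemma fin_nb [simp]: "finite {z. E y z \<and> P z}" "finite {z. E y z}"
  by (rule finite_subset[OF _ finV]; use E_V in blast)+

lemma c_pos: assumes "Suc i \<le> D" shows "cs (Suc i) > 0"
proof -
  obtain x y where xy: "x \<in> V" "y \<in> V" "d x y = Suc i" using d_attained[OF assms] by blast
  obtain z where "d x z = i" "E z y" using d_step xy by blast
  then have "{z. E y z \<and> d x z = i} \<noteq> {}" using E_sym by blast
  then show ?thesis using card_c[OF xy] by (metis card_gt_0_iff fin_nb(1))
qed

lemma b_pos: assumes "i < D" shows "bs i > 0"
proof -
  obtain x y where xy: "x \<in> V" "y \<in> V" "d x y = Suc i"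
    using d_attained[of "Suc i"] assms by auto
  obtain z where z: "d x z = i" "E z y" "z \<in> V" using d_step xy by blast
  then have "{y. E z y \<and> d x y = Suc i} \<noteq> {}" using xy by blast
  then show ?thesis using card_b[OF _ _ z(1) assms] xy z by (metis card_gt_0_iff fin_nb(1))
qed

lemma valency: assumes "x \<in> V" "0 < D" shows "card {z. E x z} = bs 0"
proof -
  have "{z. E x z \<and> d x z = Suc 0} = {z. E x z}" using d_E by auto
  then show ?thesis using card_b[of x x 0] assms by simp
qed

text \<open>The sequences \<open>bs\<close> and \<open>cs\<close> are unconstrained at \<open>D\<close> and at \<open>0\<close>; the extensions by zero
  make the intersection numbers uniform in the distance.\<close>

definition bn :: "nat \<Rightarrow> nat" where "bn i = (if i < D then bs i else 0)"
definition cn :: "nat \<Rightarrow> nat" where "cn i = (if i = 0 then 0 else cs i)"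

lemma card_bn: assumes "x \<in> V" "y \<in> V"
  shows "card {z. E y z \<and> d x z = Suc (d x y)} = bn (d x y)"
proof (cases "d x y < D")
  case False
  then have "{z. E y z \<and> d x z = Suc (d x y)} = {}" using d_le_D assms E_V by fastforce
  then show ?thesis using False by (simp add: bn_def)
qed (use card_b assms in \<open>auto simp: bn_def\<close>)

lemma card_cn: assumes "x \<in> V" "y \<in> V"
  shows "card {z. E y z \<and> Suc (d x z) = d x y} = cn (d x y)"
proof (cases "d x y")
  case (Suc i)
  then show ?thesis using card_c[OF assms Suc] by (simp add: cn_def)
qed (simp add: cn_def)

lemma nb_split: assumes "x \<in> V" "y \<in> V"
  shows "{z. E y z} = {z. E y z \<and> d x z = Suc (d x y)} \<union> {z. E y z \<and> Suc (d x z) = d x y}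
      \<union> {z. E y z \<and> d x z = d x y}"
proof -
  have "d x z = Suc (d x y) \<or> Suc (d x z) = d x y \<or> d x z = d x y" if "E y z" for z
    using d_tri_E[OF that assms(1)] d_tri_E[OF E_sym[OF that] assms(1)] by linarith
  then show ?thesis by blast
qed

lemma sum_nb_split: fixes h :: "'a \<Rightarrow> real" assumes "x \<in> V" "y \<in> V"
  shows "(\<Sum>z\<in>{z. E y z}. h z) = (\<Sum>z\<in>{z. E y z \<and> d x z = Suc (d x y)}. h z)
    + (\<Sum>z\<in>{z. E y z \<and> Suc (d x z) = d x y}. h z) + (\<Sum>z\<in>{z. E y z \<and> d x z = d x y}. h z)"
  by (subst nb_split[OF assms], subst sum.union_disjoint, simp, simp, force,
      subst sum.union_disjoint) auto

lemma card_an: assumes "x \<in> V" "y \<in> V" "0 < D"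
  shows "real (card {z. E y z \<and> d x z = d x y}) = real (bs 0) - real (bn (d x y)) - real (cn (d x y))"
  using sum_nb_split[OF assms(1,2), of "\<lambda>_. 1"] valency[of y] card_bn card_cn assms by simp

text \<open>For counting lines on \<open>y\<close> that never leave a ball about \<open>x\<close>:
  their points other than \<open>y\<close> all lie in this set.\<close>

lemma card_within: assumes "x \<in> V" "y \<in> V" "0 < D"
  shows "real (card {z. E y z \<and> d x z \<le> d x y}) = real (bs 0) - real (bn (d x y))"
proof -
  have "{z. E y z} = {z. E y z \<and> d x z \<le> d x y} \<union> {z. E y z \<and> d x z = Suc (d x y)}"
    using d_tri_E assms le_Suc_eq by auto
  moreover have "card ({z. E y z \<and> d x z \<le> d x y} \<union> {z. E y z \<and> d x z = Suc (d x y)}) =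
      card {z. E y z \<and> d x z \<le> d x y} + card {z. E y z \<and> d x z = Suc (d x y)}"
    by (rule card_Un_disjoint) auto
  ultimately show ?thesis using card_bn[OF assms(1,2)] valency[of y] assms by simp
qed

end

section \<open>The smallest eigenvalue and the clique bound\<close>

text \<open>The Gaussian number as a natural number, so that it can serve as a cardinality. Its
  recursion \<open>gnum_Suc\<close> is the one satisfied by cones in a projective space.\<close>

definition gnum :: "nat \<Rightarrow> nat \<Rightarrow> nat" where "gnum q i = (\<Sum>j<i. q ^ j)"

lemma gnum_Suc: "gnum q (Suc i) = 1 + q * gnum q i"
  unfolding gnum_def sum.lessThan_Suc_shift by (simp add: sum_distrib_left)

lemma gnum_simps [simp]: "gnum q 0 = 0" "gnum q (Suc 0) = 1"
  by (simp_all add: gnum_def)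

lemma gnum_2: "gnum q 2 = q + 1" and gnum_3: "gnum q 3 = q\<^sup>2 + q + 1"
  and gnum_4: "gnum q 4 = (q + 1) * (q\<^sup>2 + 1)"
  by (simp_all add: numeral_eq_Suc gnum_Suc algebra_simps)

lemma gnum_mono: "i \<le> j \<Longrightarrow> gnum q i \<le> gnum q j"
  unfolding gnum_def by (rule sum_mono2) auto

lemma gnum_qnum: assumes "q \<ge> 2" shows "real (gnum q i) = qnum (int q) i"
  unfolding gnum_def qnum_def using assms by (simp add: geometric_sum)

context drg_graph
begin

section \<open>Sphere sums of eigenfunctions and finiteness of the spectrum\<close>

definition an :: "nat \<Rightarrow> real" where "an i = real (bs 0) - real (bn i) - real (cn i)"

definition eigfun :: "real \<Rightarrow> ('a \<Rightarrow> real) \<Rightarrow> bool" where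
  "eigfun \<theta> g \<longleftrightarrow> (\<forall>x\<in>V. (\<Sum>y\<in>{y. E x y}. g y) = \<theta> * g x)"

definition shell :: "'a \<Rightarrow> ('a \<Rightarrow> real) \<Rightarrow> nat \<Rightarrow> real" where
  "shell x g i = (\<Sum>z\<in>{z\<in>V. d x z = i}. g z)"

lemma nb_count: assumes "x \<in> V" "w \<in> V" "0 < D"
  shows "real (card {z. E w z \<and> d x z = i}) =
     (if d x w = Suc i then real (cn (Suc i)) else 0) + (if d x w = i then an i else 0)
     + (if Suc (d x w) = i then real (bn (d x w)) else 0)"
proof -
  consider "d x w = Suc i" | "d x w = i" | "Suc (d x w) = i"
    | "d x w \<noteq> Suc i" "d x w \<noteq> i" "Suc (d x w) \<noteq> i" by blast
  then show ?thesis
  proof cases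
    case 1 then show ?thesis using card_cn[OF assms(1,2)] by simp
  next
    case 2 then show ?thesis using card_an[OF assms] by (simp add: an_def)
  next
    case 3 then show ?thesis using card_bn[OF assms(1,2)] by simp
  next
    case 4
    have "d x z = Suc (d x w) \<or> Suc (d x z) = d x w \<or> d x z = d x w" if "E w z" for z
      using that nb_split[OF assms(1,2)] by blast
    then have "{z. E w z \<and> d x z = i} = {}" using 4 by fastforce
    then show ?thesis using 4 by simp
  qed
qed

lemma sum_if_filter: "(\<Sum>w\<in>V. (if P w then c else 0) * g w) = (c::real) * (\<Sum>w\<in>{w\<in>V. P w}. g w)"
proof -
  have "(\<Sum>w\<in>V. (if P w then c else 0) * g w) = (\<Sum>w\<in>V. if P w then c * g w else 0)"
    by (rule sum.cong) auto
  also have "\<dots> = (\<Sum>w\<in>{w\<in>V. P w}. c * g w)" by (rule sum.inter_filter[symmetric]) simp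
  finally show ?thesis by (simp only: sum_distrib_left)
qed

text \<open>Sum the eigenvalue equation over the sphere of radius \<open>i\<close> and interchange
  the sums: a vertex at distance \<open>i - 1\<close>, \<open>i\<close> or \<open>i + 1\<close> is
  then counted \<open>b_(i-1)\<close>, \<open>a_i\<close> or \<open>c_(i+1)\<close> times.\<close>

lemma shell_rec: assumes "x \<in> V" "eigfun \<theta> g" "0 < D"
  shows "\<theta> * shell x g i = (if i = 0 then 0 else real (bn (i - 1)) * shell x g (i - 1))
    + an i * shell x g i + real (cn (Suc i)) * shell x g (Suc i)"
proof -
  have "\<theta> * shell x g i = (\<Sum>z\<in>{z\<in>V. d x z = i}. \<Sum>w\<in>{w. E z w}. g w)"
    using assms(2) unfolding shell_def eigfun_def sum_distrib_left by (intro sum.cong) auto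
  also have "\<dots> = (\<Sum>z\<in>{z\<in>V. d x z = i}. \<Sum>w\<in>{w\<in>V. E z w}. g w)"
    by (intro sum.cong refl) (use E_V in auto)
  also have "\<dots> = (\<Sum>w\<in>V. \<Sum>z\<in>{z\<in>{z\<in>V. d x z = i}. E z w}. g w)"
    by (rule sum.swap_restrict) auto
  also have "\<dots> = (\<Sum>w\<in>V. real (card {z. E w z \<and> d x z = i}) * g w)"
  proof (rule sum.cong[OF refl])
    fix w
    have "{z\<in>{z\<in>V. d x z = i}. E z w} = {z. E w z \<and> d x z = i}" using E_V E_commute by auto
    then show "(\<Sum>z\<in>{z\<in>{z\<in>V. d x z = i}. E z w}. g w) = real (card {z. E w z \<and> d x z = i}) * g w"
      by simp
  qed
  also have "\<dots> = (\<Sum>w\<in>V. (if d x w = Suc i then real (cn (Suc i)) else 0) * g w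
     + (if d x w = i then an i else 0) * g w
     + (if Suc (d x w) = i then real (bn (i - 1)) else 0) * g w)"
    by (rule sum.cong[OF refl]) (use nb_count assms in \<open>auto simp: algebra_simps\<close>)
  also have "\<dots> = real (cn (Suc i)) * shell x g (Suc i) + an i * shell x g i
     + real (bn (i - 1)) * (\<Sum>w\<in>{w\<in>V. Suc (d x w) = i}. g w)"
    by (simp add: sum.distrib sum_if_filter shell_def)
  also have "real (bn (i - 1)) * (\<Sum>w\<in>{w\<in>V. Suc (d x w) = i}. g w)
     = (if i = 0 then 0 else real (bn (i - 1)) * shell x g (i - 1))"
    by (cases i) (auto simp: shell_def)
  finally show ?thesis by simp
qed

lemma shell_0: "x \<in> V \<Longrightarrow> shell x g 0 = g x"
proof -
  assume "x \<in> V"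
  then have "{z\<in>V. d x z = 0} = {x}" using d_0 by auto
  then show ?thesis by (simp add: shell_def)
qed

lemma shell_beyond: "x \<in> V \<Longrightarrow> i > D \<Longrightarrow> shell x g i = 0"
proof -
  assume "x \<in> V" "i > D"
  then have "{z\<in>V. d x z = i} = {}" using d_le_D by fastforce
  then show ?thesis unfolding shell_def by (simp only: sum.empty)
qed

text \<open>A nonzero stand-in for \<open>c_i\<close>, because the recursion of
  \<open>shell_poly\<close> divides by it. At \<open>D + 1\<close> the sphere is empty, so any
  nonzero value serves.\<close>

definition cpos :: "nat \<Rightarrow> real" where "cpos i = (if i \<le> D then real (cn i) else 1)"

lemma cpos_pos: "cpos (Suc i) > 0"
  using c_pos by (auto simp: cpos_def cn_def)

text \<open>The distance polynomials, which express the distance matrices in terms of the adjacency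
  matrix, continued to index \<open>D + 1\<close>, where every eigenvalue is a root.\<close>

fun shell_poly :: "nat \<Rightarrow> real poly" where
  "shell_poly 0 = 1"
| "shell_poly (Suc 0) = smult (1 / cpos 1) [:- an 0, 1:]"
| "shell_poly (Suc (Suc i)) = smult (1 / cpos (Suc (Suc i)))
     ([:- an (Suc i), 1:] * shell_poly (Suc i) - smult (real (bn i)) (shell_poly i))"

lemma degree_shell_poly: "degree (shell_poly i) = i"
proof (induction i rule: shell_poly.induct)
  case (3 i)
  have "shell_poly (Suc i) \<noteq> 0" using 3(1) by (metis degree_0 nat.distinct(1))
  then have "degree ([:- an (Suc i), 1:] * shell_poly (Suc i)) = Suc (Suc i)"
    using 3(1) by (subst degree_mult_eq) auto
  moreover have "degree (smult (real (bn i)) (shell_poly i)) < Suc (Suc i)"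
    using 3(2) degree_smult_le[of "real (bn i)" "shell_poly i"] by linarith
  ultimately have "degree ([:- an (Suc i), 1:] * shell_poly (Suc i)
      + - smult (real (bn i)) (shell_poly i)) = Suc (Suc i)"
    by (subst degree_add_eq_left) (auto simp del: mult_pCons_left)
  then show ?case using cpos_pos[of "Suc i"] by (simp del: mult_pCons_left)
qed (use cpos_pos[of 0] in auto)

lemma shell_eq_poly: assumes "x \<in> V" "eigfun \<theta> g" "0 < D"
  shows "i \<le> Suc D \<Longrightarrow> shell x g i = poly (shell_poly i) \<theta> * g x"
proof (induction i rule: shell_poly.induct)
  case 1
  then show ?case using shell_0 assms by simp
next
  case 2
  have "\<theta> * g x = an 0 * g x + cpos 1 * shell x g 1"
    using shell_rec[OF assms, of 0] shell_0[OF assms(1)] assms(3) by (simp add: cpos_def)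
  then show ?case using cpos_pos[of 0] by (simp add: field_simps)
next
  case (3 i)
  have "real (cn (Suc (Suc i))) * shell x g (Suc (Suc i)) = cpos (Suc (Suc i)) * shell x g (Suc (Suc i))"
    using shell_beyond[OF assms(1), of "Suc (Suc i)"] by (auto simp: cpos_def)
  then have "\<theta> * shell x g (Suc i) = real (bn i) * shell x g i + an (Suc i) * shell x g (Suc i)
      + cpos (Suc (Suc i)) * shell x g (Suc (Suc i))"
    using shell_rec[OF assms, of "Suc i"] by simp
  then show ?case using 3 cpos_pos[of "Suc i"] by (simp add: field_simps)
qed

lemma adj_eigenvalue_eigfun: "adj_eigenvalue V E \<theta> \<longleftrightarrow> (\<exists>g. (\<exists>x\<in>V. g x \<noteq> 0) \<and> eigfun \<theta> g)"
proof -
  have "{y\<in>V. E x y} = {y. E x y}" for x using E_V by auto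
  then show ?thesis unfolding adj_eigenvalue_def eigfun_def by simp
qed

text \<open>\<open>theta_min\<close> is a \<open>Min\<close>, so it is the least eigenvalue only
  once the spectrum is known to be finite.\<close>

lemma finite_eigenvalues: assumes "0 < D" shows "finite {\<theta>. adj_eigenvalue V E \<theta>}"
proof (rule finite_subset)
  show "{\<theta>. adj_eigenvalue V E \<theta>} \<subseteq> {\<theta>. poly (shell_poly (Suc D)) \<theta> = 0}"
  proof
    fix \<theta> assume "\<theta> \<in> {\<theta>. adj_eigenvalue V E \<theta>}"
    then obtain g x where g: "x \<in> V" "g x \<noteq> 0" "eigfun \<theta> g"
      by (auto simp: adj_eigenvalue_eigfun)
    then show "\<theta> \<in> {\<theta>. poly (shell_poly (Suc D)) \<theta> = 0}"
      using shell_eq_poly[OF g(1,3) assms, of "Suc D"] shell_beyond[OF g(1), of "Suc D"] by auto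
  qed
  have "shell_poly (Suc D) \<noteq> 0" using degree_shell_poly[of "Suc D"] by (metis degree_0 nat.distinct(1))
  then show "finite {\<theta>. poly (shell_poly (Suc D)) \<theta> = 0}" by (rule poly_roots_finite)
qed

text \<open>Radial functions of one variable act on an eigenfunction by a scalar, which makes the
  matrix with entries \<open>u (d x y)\<close> a multiple of a projection, hence positive semidefinite.\<close>

lemma radial_sum: assumes "x \<in> V" "eigfun \<theta> g" "0 < D"
  shows "(\<Sum>z\<in>V. u (d x z) * g z) = (\<Sum>i\<le>D. u i * poly (shell_poly i) \<theta>) * g x"
proof -
  have "(\<Sum>z\<in>V. u (d x z) * g z) = (\<Sum>i\<le>D. \<Sum>z\<in>{z\<in>V. d x z = i}. u (d x z) * g z)"
    by (rule sum.group[symmetric]) (use d_le_D assms in auto)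
  also have "\<dots> = (\<Sum>i\<le>D. u i * shell x g i)"
    unfolding shell_def sum_distrib_left by (intro sum.cong) auto
  also have "\<dots> = (\<Sum>i\<le>D. u i * (poly (shell_poly i) \<theta> * g x))"
    using shell_eq_poly[OF assms] by (intro sum.cong) auto
  finally show ?thesis by (simp add: sum_distrib_right mult.assoc)
qed

end

section \<open>The eigenfunction of the eigenvalue -[D] and Delsarte's clique bound\<close>

locale classical_drg = drg_graph +
  fixes q :: nat and \<alpha> \<beta> :: real
  assumes q2: "q \<ge> 2" and D3: "D \<ge> 3"
    and bs_eq: "i < D \<Longrightarrow> real (bs i) = (real (gnum q D) - real (gnum q i)) * (\<beta> - \<alpha> * real (gnum q i))"
    and cs_eq: "Suc i \<le> D \<Longrightarrow> real (cs (Suc i)) = real (gnum q (Suc i)) * (1 + \<alpha> * real (gnum q i))"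
begin

abbreviation qn :: "nat \<Rightarrow> real" where "qn i \<equiv> real (gnum q i)"
abbreviation r :: real where "r \<equiv> qn D"

lemma D0: "0 < D" using D3 by simp

lemma bn_eq: "i \<le> D \<Longrightarrow> real (bn i) = (r - qn i) * (\<beta> - \<alpha> * qn i)"
  using bs_eq by (auto simp: bn_def)

lemma cn_eq: "Suc i \<le> D \<Longrightarrow> real (cn (Suc i)) = qn (Suc i) * (1 + \<alpha> * qn i)"
  using cs_eq by (auto simp: cn_def)

lemma k_eq: "real (bs 0) = r * \<beta>"
  using bs_eq[of 0] D3 by simp

lemma r_ge: "r \<ge> qn 3"
  using gnum_mono[OF D3] by simp

lemma r_pos: "r > 0"
  using r_ge zero_le_power2[of "real q"] unfolding gnum_3 by (simp only: of_nat_add)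

lemma \<beta>_pos: "\<beta> > 0"
  using b_pos[OF D0] k_eq r_pos by (metis of_nat_0_less_iff zero_less_mult_pos)

text \<open>The cosine sequence of the eigenvalue \<open>- r\<close>: the values of an eigenfunction
  that depends only on the distance to a base vertex. For \<open>i < D\<close> the denominator is
  nonzero because \<open>b_i\<close> is.\<close>

primrec u :: "nat \<Rightarrow> real" where
  "u 0 = 1"
| "u (Suc i) = - u i * (1 + \<alpha> * qn i) / (\<beta> - \<alpha> * qn i)"

declare u.simps(2) [simp del]

lemma u_eq: "i < D \<Longrightarrow> u (Suc i) * (\<beta> - \<alpha> * qn i) = - u i * (1 + \<alpha> * qn i)"
  using b_pos[of i] bs_eq[of i] by (auto simp: u.simps(2))

text \<open>The \<open>b_i\<close> term and the \<open>c_i\<close> term are each an explicit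
  multiple of \<open>u i\<close>; at \<open>i = D\<close> the factor \<open>r - qn i\<close>
  vanishes.\<close>

lemma u_rec: assumes "i \<le> D"
  shows "real (bn i) * u (Suc i) + real (cn i) * u (i - 1) + an i * u i = - r * u i"
proof -
  have b: "real (bn i) * u (Suc i) = - (r - qn i) * (1 + \<alpha> * qn i) * u i"
  proof (cases "i < D")
    case True
    have "real (bn i) * u (Suc i) = (r - qn i) * (u (Suc i) * (\<beta> - \<alpha> * qn i))"
      using bn_eq assms by simp
    then show ?thesis unfolding u_eq[OF True] by (simp add: algebra_simps)
  qed (use assms bn_eq[of i] in auto)
  show ?thesis
  proof (cases i)
    case 0
    then show ?thesis using b k_eq bn_eq[of 0] by (simp add: an_def cn_def)
  next
    case (Suc j)
    have c: "real (cn i) * u (i - 1) = - qn i * (u (Suc j) * (\<beta> - \<alpha> * qn j))"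
      using u_eq[of j] assms Suc cn_eq[of j] by simp
    have a: "an i = r * \<beta> - (r - qn i) * (\<beta> - \<alpha> * qn i) - qn i * (1 + \<alpha> * qn j)"
      using assms Suc k_eq bn_eq[of i] cn_eq[of j] by (simp add: an_def)
    show ?thesis unfolding b c a using Suc by (simp add: algebra_simps)
  qed
qed

lemma eigfun_u: assumes "x \<in> V" shows "eigfun (- r) (\<lambda>z. u (d x z))"
  unfolding eigfun_def
proof
  fix y assume y: "y \<in> V"
  have "(\<Sum>z\<in>{z. E y z}. u (d x z)) = real (bn (d x y)) * u (Suc (d x y))
     + (\<Sum>z\<in>{z. E y z \<and> Suc (d x z) = d x y}. u (d x z)) + an (d x y) * u (d x y)"
    using sum_nb_split[OF assms y, of "\<lambda>z. u (d x z)"] card_bn[OF assms y] card_an[OF assms y D0]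
    by (simp add: an_def)
  also have "(\<Sum>z\<in>{z. E y z \<and> Suc (d x z) = d x y}. u (d x z))
     = (\<Sum>z\<in>{z. E y z \<and> Suc (d x z) = d x y}. u (d x y - 1))"
    by (rule sum.cong) (auto simp: diff_Suc_1 dest: sym)
  also have "\<dots> = real (cn (d x y)) * u (d x y - 1)"
    using card_cn[OF assms y] by simp
  finally show "(\<Sum>z\<in>{z. E y z}. u (d x z)) = - r * u (d x y)"
    using u_rec[OF d_le_D[OF assms y]] by simp
qed

text \<open>The matrix with entries \<open>u (d x y)\<close> is positive semidefinite, since its
  square is a positive multiple of it. Its quadratic form at the indicator of a clique sees only
  \<open>u 0 = 1\<close> and \<open>u 1 = - 1 / \<beta>\<close>.\<close>

lemma clique_bound: assumes "is_clique V E C" shows "real (card C) \<le> 1 + \<beta>"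
proof (cases "C = {}")
  case False
  have CV: "C \<subseteq> V" and CE: "\<And>y z. y \<in> C \<Longrightarrow> z \<in> C \<Longrightarrow> y \<noteq> z \<Longrightarrow> E y z"
    using assms by (auto simp: is_clique_def)
  have fC: "finite C" using CV finV finite_subset by blast
  define cc where "cc = (\<Sum>i\<le>D. u i * poly (shell_poly i) (- r))"
  have rep: "(\<Sum>z\<in>V. u (d x z) * u (d y z)) = cc * u (d y x)" if "x \<in> V" "y \<in> V" for x y
    using radial_sum[OF that(1) eigfun_u[OF that(2)] D0] by (simp add: cc_def)
  have cc: "cc > 0"
  proof -
    obtain x where x: "x \<in> V" using V_ne by blast
    have "0 < (\<Sum>z\<in>V. u (d x z) * u (d x z))"
      using x by (intro sum_pos2[of _ x]) auto
    then show ?thesis using rep[OF x x] by simp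
  qed
  have inner: "(\<Sum>y'\<in>C. cc * u (d y' y)) = cc * (1 - (real (card C) - 1) / \<beta>)" if y: "y \<in> C" for y
  proof -
    have "(\<Sum>y'\<in>C. u (d y' y)) = u (d y y) + (\<Sum>y'\<in>C - {y}. u (d y' y))"
      using fC y by (rule sum.remove)
    also have "(\<Sum>y'\<in>C - {y}. u (d y' y)) = (\<Sum>y'\<in>C - {y}. - 1 / \<beta>)"
      using CE y d_E by (intro sum.cong) (auto simp: u.simps(2))
    also have "\<dots> = - ((real (card C) - 1) / \<beta>)"
    proof -
      have "card C = Suc (card (C - {y}))" using fC y by (metis card.remove)
      then show ?thesis by simp
    qed
    finally have "(\<Sum>y'\<in>C. u (d y' y)) = 1 - (real (card C) - 1) / \<beta>" by simp
    then show ?thesis by (simp only: sum_distrib_left[symmetric])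
  qed
  have "0 \<le> (\<Sum>z\<in>V. (\<Sum>y\<in>C. u (d y z)) * (\<Sum>y\<in>C. u (d y z)))"
    by (rule sum_nonneg) simp
  also have "\<dots> = (\<Sum>z\<in>V. \<Sum>y\<in>C. \<Sum>y'\<in>C. u (d y z) * u (d y' z))"
    by (simp add: sum_product)
  also have "\<dots> = (\<Sum>y\<in>C. \<Sum>y'\<in>C. \<Sum>z\<in>V. u (d y z) * u (d y' z))"
    by (subst sum.swap, rule sum.cong[OF refl], rule sum.swap)
  also have "\<dots> = (\<Sum>y\<in>C. \<Sum>y'\<in>C. cc * u (d y' y))"
    using CV by (intro sum.cong refl rep) auto
  also have "\<dots> = real (card C) * (cc * (1 - (real (card C) - 1) / \<beta>))"
    using inner by simp
  finally have "0 \<le> 1 - (real (card C) - 1) / \<beta>"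
    using cc False fC by (simp add: zero_le_mult_iff card_gt_0_iff)
  then show ?thesis using \<beta>_pos by (simp add: field_simps)
qed (use \<beta>_pos in simp)

lemma adj_eigenvalue_min: "adj_eigenvalue V E (- r)"
proof -
  obtain x where "x \<in> V" using V_ne by blast
  then show ?thesis unfolding adj_eigenvalue_eigfun
    using eigfun_u by (intro exI[of _ "\<lambda>z. u (d x z)"]) force
qed

end

section \<open>Lines\<close>

lemma double_count:
  assumes "finite A" "finite B" "\<And>a. a \<in> A \<Longrightarrow> m \<le> card {b\<in>B. R a b}"
    and "\<And>b. b \<in> B \<Longrightarrow> card {a\<in>A. R a b} \<le> n"
  shows "m * card A \<le> n * card B"
proof -
  have "m * card A = (\<Sum>a\<in>A. m)" by simp
  also have "\<dots> \<le> (\<Sum>a\<in>A. card {b\<in>B. R a b})" using assms(3) by (rule sum_mono)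
  also have "\<dots> = (\<Sum>a\<in>A. \<Sum>b\<in>{b\<in>B. R a b}. 1)" by simp
  also have "\<dots> = (\<Sum>b\<in>B. \<Sum>a\<in>{a\<in>A. R a b}. 1)" using assms(1,2) by (rule sum.swap_restrict)
  also have "\<dots> \<le> (\<Sum>b\<in>B. n)" using assms(4) by (intro sum_mono) simp
  finally show ?thesis by (simp add: mult.commute)
qed

text \<open>The SPLS property in a form suited to counting: \<open>L_unique\<close> combines the
  partial linear space with its point graph, and \<open>\<beta> + \<alpha> * (r - 1) - 1\<close> is
  \<open>a_1\<close>.\<close>

locale line_geometry = classical_drg +
  fixes L :: "'a set set" and s :: nat
  assumes L_clique: "l \<in> L \<Longrightarrow> is_clique V E l"
    and L_unique: "E x y \<Longrightarrow> \<exists>!l. l \<in> L \<and> x \<in> l \<and> y \<in> l"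
    and card_on: "x \<in> V \<Longrightarrow> card {l\<in>L. x \<in> l} \<le> s"
    and tau_c2: "x \<in> V \<Longrightarrow> l \<in> L \<Longrightarrow> x \<notin> l \<Longrightarrow> card {y\<in>l. E x y} \<le> cs 2"
    and s2: "s \<ge> 2"
    and size0: "l \<in> L \<Longrightarrow> real (card l) \<ge> \<beta> + \<alpha> * (r - 1) + 1 - (real (cs 2) - 1) * (real s - 1)"
    and a1_ge: "\<beta> + \<alpha> * (r - 1) - 1 \<ge> (2 * real s - 1) * (real (cs 2) - 1)"
    and h1: "\<beta> > (real q + 2) * (real q + 1) * (real s - 1) - (real q * (real q + 1) + r - 1) * \<alpha>"
    and h2: "\<beta> > ((real q + 1) * (real q ^ 2 + real q + 1) - 2) * (real s - real q)
               - \<alpha> * (real q + 1) * r + \<alpha> * (real q + 1) ^ 2"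
    and h3: "\<beta> > ((real q + 1) * (real q ^ 2 + real q + 1) - 2 + real q) * (real s - real q)
               - \<alpha> * (r - 1) + real q ^ 2 - real q"
begin

definition on :: "'a \<Rightarrow> 'a set set" where "on x = {l\<in>L. x \<in> l}"

lemma L_V: "l \<in> L \<Longrightarrow> z \<in> l \<Longrightarrow> z \<in> V"
  and L_E: "l \<in> L \<Longrightarrow> y \<in> l \<Longrightarrow> z \<in> l \<Longrightarrow> y \<noteq> z \<Longrightarrow> E y z"
  using L_clique by (auto simp: is_clique_def)

lemma L_fin: "l \<in> L \<Longrightarrow> finite l"
  using L_V finite_subset[OF _ finV] by blast

lemma L_finite: "finite L"
  using L_V by (intro finite_subset[of L "Pow V"]) auto

lemma on_fin [simp]: "finite (on x)"
  using L_finite by (simp add: on_def)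

lemma onD: "l \<in> on x \<Longrightarrow> l \<in> L" "l \<in> on x \<Longrightarrow> x \<in> l"
  by (auto simp: on_def)

lemma onI: "l \<in> L \<Longrightarrow> x \<in> l \<Longrightarrow> l \<in> on x"
  by (auto simp: on_def)

lemma on_card: "x \<in> V \<Longrightarrow> card (on x) \<le> s"
  using card_on by (simp add: on_def)

lemma two_points: assumes "l \<in> L" "m \<in> L" "x \<in> l" "y \<in> l" "x \<in> m" "y \<in> m" "x \<noteq> y"
  shows "l = m"
  using L_unique[OF L_E[OF assms(1,3,4,7)]] assms by blast

lemma edge_line: assumes "E x y" obtains l where "l \<in> L" "x \<in> l" "y \<in> l"
  using L_unique[OF assms] by blast

lemma line_d: assumes "l \<in> L" "y \<in> l" "z \<in> l" "w \<in> V" shows "d w z \<le> Suc (d w y)"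
  using d_tri_E[OF L_E] assms by (cases "y = z") auto

text \<open>Two lines on \<open>x\<close> share only \<open>x\<close>, so the lines partition its
  neighbours. Most counts below are distributed over lines in this way.\<close>

lemma card_nb_lines: assumes "x \<in> V"
  shows "card {z. E x z \<and> P z} = (\<Sum>l\<in>on x. card {z\<in>l - {x}. P z})"
proof -
  have "{z. E x z \<and> P z} = (\<Union>l\<in>on x. {z\<in>l - {x}. P z})"
  proof (intro equalityI subsetI)
    fix z assume "z \<in> {z. E x z \<and> P z}"
    then have z: "E x z" "P z" by auto
    then obtain l where "l \<in> L" "x \<in> l" "z \<in> l" using edge_line by blast
    then show "z \<in> (\<Union>l\<in>on x. {z\<in>l - {x}. P z})" using z by (auto simp: on_def)
  qed (use L_E in \<open>auto simp: on_def\<close>)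
  moreover have "card (\<Union>l\<in>on x. {z\<in>l - {x}. P z}) = (\<Sum>l\<in>on x. card {z\<in>l - {x}. P z})"
  proof (rule card_UN_disjoint)
    show "\<forall>l\<in>on x. \<forall>m\<in>on x. l \<noteq> m \<longrightarrow> {z\<in>l - {x}. P z} \<inter> {z\<in>m - {x}. P z} = {}"
      using two_points by (fastforce simp: on_def)
  qed (use L_fin onD in auto)
  ultimately show ?thesis by simp
qed

lemma card_minus: "l \<in> on x \<Longrightarrow> real (card (l - {x})) = real (card l) - 1"
proof -
  assume l: "l \<in> on x"
  then have "card l = Suc (card (l - {x}))" using L_fin onD by (metis card.remove)
  then show ?thesis by simp
qed

lemma valency_lines: assumes "x \<in> V"
  shows "r * \<beta> = (\<Sum>l\<in>on x. real (card l) - 1)"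
proof -
  have "r * \<beta> = real (\<Sum>l\<in>on x. card {z\<in>l - {x}. True})"
    using card_nb_lines[OF assms, of "\<lambda>_. True"] valency[OF assms D0] k_eq by simp
  also have "\<dots> = (\<Sum>l\<in>on x. real (card (l - {x})))" by (simp add: set_diff_eq)
  also have "\<dots> = (\<Sum>l\<in>on x. real (card l) - 1)" using card_minus by (intro sum.cong) auto
  finally show ?thesis .
qed

lemma on_ge_r: assumes "x \<in> V" shows "r \<le> real (card (on x))"
proof -
  have "r * \<beta> \<le> (\<Sum>l\<in>on x. \<beta>)" unfolding valency_lines[OF assms]
    using clique_bound L_clique onD by (intro sum_mono) fastforce
  then show ?thesis using \<beta>_pos by simp
qed

lemma s_ge: "real s \<ge> r"
proof -
  obtain x where "x \<in> V" using V_ne by blast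
  then show ?thesis using on_ge_r[of x] on_card[of x] by simp
qed

lemma s_ge': "real s \<ge> real q ^ 2 + real q + 1"
  using s_ge r_ge by (simp add: gnum_3)

lemma c2_eq: "real (cs 2) = (real q + 1) * (1 + \<alpha>)"
  using cs_eq[of "Suc 0"] D3 gnum_2[of q] by (simp add: numeral_2_eq_2)

lemma c3_eq: "real (cs 3) = (real q ^ 2 + real q + 1) * (1 + \<alpha> * (real q + 1))"
  using cs_eq[of 2] D3 gnum_2[of q] gnum_3[of q] by (simp add: numeral_3_eq_3 numeral_2_eq_2 add_ac)

text \<open>\<open>\<alpha> (q + 1)\<close> is an integer because \<open>c\<^sub>2\<close> is one, and it exceeds \<open>-1\<close> because \<open>c\<^sub>3 > 0\<close>.\<close>

lemma \<alpha>_nonneg: "\<alpha> \<ge> 0"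
proof -
  have "0 < real (cs 3)" using c_pos[of 2] D3 by (simp add: numeral_3_eq_3)
  then have "0 < 1 + \<alpha> * (real q + 1)" unfolding c3_eq
    by (rule zero_less_mult_pos) (intro add_nonneg_pos add_nonneg_nonneg; simp)
  then have "real q < real (cs 2)" unfolding c2_eq by (simp add: algebra_simps)
  then have "real q + 1 \<le> real (cs 2)" by simp
  then have "0 \<le> (real q + 1) * \<alpha>" unfolding c2_eq by (simp add: algebra_simps)
  then show ?thesis by (simp add: zero_le_mult_iff)
qed

lemma c2_ge: "cs 2 \<ge> q + 1"
proof -
  have "(real q + 1) * 1 \<le> (real q + 1) * (1 + \<alpha>)" using \<alpha>_nonneg by (intro mult_left_mono) auto
  then have "real (q + 1) \<le> real (cs 2)" using c2_eq by (simp add: add.commute)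
  then show ?thesis by (simp only: of_nat_le_iff)
qed

section \<open>Sizes of lines and the bound on \<tau>\<close>

lemma size_gt_c2: assumes "l \<in> L" shows "card l > cs 2"
proof -
  have "real s * (real (cs 2) - 1) \<ge> 2 * (real (cs 2) - 1)"
    using s2 c2_ge by (intro mult_right_mono) auto
  then have "real (card l) \<ge> 2 * (real (cs 2) - 1) + 2"
    using size0[OF assms] a1_ge by (simp add: algebra_simps)
  then have "real (cs 2) < real (card l)" using of_nat_mono[OF c2_ge, where 'a = real] q2 by simp
  then show ?thesis by simp
qed

lemma common_nb: assumes "x \<in> V" "y \<in> V" "d x y = 2"
  shows "card {z. E x z \<and> E y z} = cs 2"
proof -
  have "{z. E x z \<and> E y z} = {z. E y z \<and> d x z = Suc 0}" using d_1 E_V assms by blast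
  then show ?thesis using card_c[of x y "Suc 0"] assms by (simp add: numeral_2_eq_2)
qed

lemma common_nb_ex: assumes "x \<in> V" "y \<in> V" "d x y = 2" obtains z where "E x z" "E y z"
proof -
  have "{z. E x z \<and> E y z} \<noteq> {}" using common_nb[OF assms] c2_ge by (metis add_is_0 card.empty le_zero_eq one_neq_zero)
  then show ?thesis using that by blast
qed

text \<open>Count \<open>a_1\<close> for an edge of \<open>l\<close>: a common neighbour of its ends
  \<open>x\<close> and \<open>y\<close> lies on \<open>l\<close>, or is one of at most
  \<open>t - 1\<close> neighbours of \<open>y\<close>, other than \<open>x\<close>, on another line
  through \<open>x\<close>. The parameter \<open>t\<close> turns each improvement of the bound on
  \<tau> into longer lines.\<close>

lemma size_lower:
  assumes tau: "\<And>x l. x \<in> V \<Longrightarrow> l \<in> L \<Longrightarrow> x \<notin> l \<Longrightarrow> card {y\<in>l. E x y} \<le> t"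
    and t: "t \<ge> 1" and l: "l \<in> L"
  shows "real (card l) - 1 \<ge> \<beta> + \<alpha> * (r - 1) - (real s - 1) * (real t - 1)"
proof -
  have "card l \<ge> 2" using size_gt_c2[OF l] c2_ge q2 by simp
  then have "\<not> card l \<le> Suc 0" by simp
  then obtain x y where xy: "x \<in> l" "y \<in> l" "x \<noteq> y"
    using card_le_Suc0_iff_eq[OF L_fin[OF l]] by blast
  have V: "x \<in> V" "y \<in> V" and e: "E x y" using xy l L_V L_E by auto
  have "E y z \<longleftrightarrow> d y z = d y x" if "E x z" for z
    using d_1[OF V(2) E_V(2)[OF that]] d_E[OF E_sym[OF e]] by simp
  then have "{z. E x z \<and> E y z} = {z. E x z \<and> d y z = d y x}" by blast
  then have "real (card {z. E x z \<and> E y z}) = real (bs 0) - real (bn 1) - real (cn 1)"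
    using card_an[OF V(2,1) D0] d_E[OF E_sym[OF e]] by simp
  also have "\<dots> = \<beta> + \<alpha> * (r - 1) - 1"
    using k_eq bn_eq[of 1] cn_eq[of 0] D3 by (simp add: algebra_simps)
  finally have a: "\<beta> + \<alpha> * (r - 1) - 1 = real (\<Sum>m\<in>on x. card {z\<in>m - {x}. E y z})"
    using card_nb_lines[OF V(1)] by simp
  have lon: "l \<in> on x" using l xy by (rule_tac onI)
  have "(\<Sum>m\<in>on x. card {z\<in>m - {x}. E y z}) =
      card {z\<in>l - {x}. E y z} + (\<Sum>m\<in>on x - {l}. card {z\<in>m - {x}. E y z})"
    using lon by (intro sum.remove) auto
  moreover have "card {z\<in>l - {x}. E y z} + 2 \<le> card l"
  proof -
    have "{z\<in>l - {x}. E y z} = l - {x, y}" using L_E[OF l xy(2)] by auto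
    moreover have "card (l - {x, y}) = card l - 2"
      using xy L_fin[OF l] by (subst card_Diff_subset) auto
    ultimately show ?thesis using \<open>card l \<ge> 2\<close> by simp
  qed
  moreover have "(\<Sum>m\<in>on x - {l}. card {z\<in>m - {x}. E y z}) \<le> (\<Sum>m\<in>on x - {l}. t - 1)"
  proof (rule sum_mono)
    fix m assume m: "m \<in> on x - {l}"
    then have mL: "m \<in> L" "x \<in> m" using onD by auto
    then have ym: "y \<notin> m" using two_points[of m l x y] m xy l by auto
    have "{z\<in>m. E y z} = insert x {z\<in>m - {x}. E y z}" using mL e E_sym by auto
    then have "card {z\<in>m. E y z} = Suc (card {z\<in>m - {x}. E y z})"
      using L_fin[OF mL(1)] by simp
    then show "card {z\<in>m - {x}. E y z} \<le> t - 1"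
      using tau[OF V(2) mL(1) ym] by simp
  qed
  moreover have "(\<Sum>m\<in>on x - {l}. t - 1) \<le> (s - 1) * (t - 1)"
  proof -
    have "card (on x - {l}) \<le> s - 1" using lon on_card[OF V(1)] by simp
    then show ?thesis by simp
  qed
  ultimately have "(\<Sum>m\<in>on x. card {z\<in>m - {x}. E y z}) + 2 \<le> card l + (s - 1) * (t - 1)"
    by linarith
  then have "real (\<Sum>m\<in>on x. card {z\<in>m - {x}. E y z}) + 2 \<le> real (card l) + real ((s - 1) * (t - 1))"
    by linarith
  moreover have "real ((s - 1) * (t - 1)) = (real s - 1) * (real t - 1)"
    using s2 t by (simp add: of_nat_diff)
  ultimately show ?thesis using a by linarith
qed

text \<open>The right side is \<open>k - b_i\<close> for \<open>i = d w x\<close>: every point of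
  these lines other than \<open>x\<close> is a neighbour of \<open>x\<close> within distance
  \<open>i\<close> of \<open>w\<close>.\<close>

lemma lines_within:
  assumes "x \<in> V" "w \<in> V" "M \<subseteq> on x" and M: "\<And>m z. m \<in> M \<Longrightarrow> z \<in> m \<Longrightarrow> d w z \<le> d w x"
  shows "(\<Sum>m\<in>M. real (card m) - 1) \<le> qn (d w x) * (\<beta> + \<alpha> * (r - qn (d w x)))"
proof -
  have "(\<Sum>m\<in>M. real (card m) - 1) = (\<Sum>m\<in>M. real (card {z\<in>m - {x}. d w z \<le> d w x}))"
  proof (rule sum.cong[OF refl])
    fix m assume m: "m \<in> M"
    then have "{z\<in>m - {x}. d w z \<le> d w x} = m - {x}" using M by blast
    then show "real (card m) - 1 = real (card {z\<in>m - {x}. d w z \<le> d w x})"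
      using card_minus m assms(3) by auto
  qed
  also have "\<dots> \<le> (\<Sum>m\<in>on x. real (card {z\<in>m - {x}. d w z \<le> d w x}))"
    using assms(3) by (intro sum_mono2) auto
  also have "\<dots> = real (bs 0) - real (bn (d w x))"
    using card_within[OF assms(2,1) D0] card_nb_lines[OF assms(1)] by simp
  also have "\<dots> = qn (d w x) * (\<beta> + \<alpha> * (r - qn (d w x)))"
    using k_eq bn_eq[OF d_le_D[OF assms(2,1)]] by (simp add: algebra_simps)
  finally show ?thesis .
qed

lemma meet_d: assumes "l \<in> L" "m \<in> L" "v \<in> l" "v \<in> m" "y \<in> l" "z \<in> m" shows "d y z \<le> 2"
proof -
  have V: "v \<in> V" "y \<in> V" "z \<in> V" using assms L_V by auto
  have "d y v \<le> 1" using line_d[OF assms(1,5,3) V(2)] by simp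
  moreover have "d y z \<le> Suc (d y v)" using line_d[OF assms(2,4,6) V(2)] .
  ultimately show ?thesis by simp
qed

lemma nonadjacent_d2: assumes "x \<in> V" "l \<in> L" "v \<in> l" "E x v" "x \<notin> l" "y \<in> l" "\<not> E x y"
  shows "d x y = 2"
proof -
  have "y \<in> V" using assms L_V by blast
  moreover have "d x y \<le> 2" using line_d[OF assms(2,3,6,1)] d_E[OF assms(4)] by simp
  moreover have "d x y \<noteq> 0" "d x y \<noteq> 1" using d_0 d_1 assms calculation by auto
  ultimately show ?thesis by linarith
qed

lemma card_meeting_lines: assumes "x \<in> V" "l \<in> L" "x \<notin> l"
  shows "card {m\<in>on x. m \<inter> l \<noteq> {}} = card {y\<in>l. E x y}"
proof -
  have "bij_betw (\<lambda>m. THE y. y \<in> m \<inter> l) {m\<in>on x. m \<inter> l \<noteq> {}} {y\<in>l. E x y}"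
  proof -
    have the: "(THE y. y \<in> m \<inter> l) = y" if "m \<in> on x" "y \<in> m" "y \<in> l" for m y
      using that assms two_points onD by (intro the_equality) fastforce+
    show ?thesis
    proof (intro bij_betwI')
      fix m n assume "m \<in> {m\<in>on x. m \<inter> l \<noteq> {}}" "n \<in> {m\<in>on x. m \<inter> l \<noteq> {}}"
      then obtain y z where yz: "m \<in> on x" "n \<in> on x" "y \<in> m" "y \<in> l" "z \<in> n" "z \<in> l" by auto
      then show "((THE y. y \<in> m \<inter> l) = (THE y. y \<in> n \<inter> l)) = (m = n)"
        using the two_points onD assms(3) by metis
    next
      fix m assume "m \<in> {m\<in>on x. m \<inter> l \<noteq> {}}"
      then obtain y where y: "m \<in> on x" "y \<in> m" "y \<in> l" by auto
      then show "(THE y. y \<in> m \<inter> l) \<in> {y\<in>l. E x y}"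
        using the[OF y] L_E[of m x y] onD assms(3) by auto
    next
      fix y assume y: "y \<in> {y\<in>l. E x y}"
      then obtain m where "m \<in> L" "x \<in> m" "y \<in> m" using edge_line by blast
      then show "\<exists>m\<in>{m\<in>on x. m \<inter> l \<noteq> {}}. y = (THE y. y \<in> m \<inter> l)"
        using the y onI by (intro bexI[of _ m]) auto
    qed
  qed
  then show ?thesis by (rule bij_betw_same_card)
qed

text \<open>Descent from \<open>c_2\<close>, because line sizes depend on the current bound. If
  \<open>x\<close> has \<open>t + 1\<close> neighbours on \<open>l\<close>, take \<open>y\<close> on
  \<open>l\<close> not adjacent to \<open>x\<close>: the \<open>t + 1\<close> lines on
  \<open>x\<close> meeting \<open>l\<close> all stay within distance two of \<open>y\<close>, which
  is too many.\<close>

lemma tau: assumes "x \<in> V" "l \<in> L" "x \<notin> l" shows "card {y\<in>l. E x y} \<le> q + 1"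
proof -
  have "\<forall>x l. x \<in> V \<longrightarrow> l \<in> L \<longrightarrow> x \<notin> l \<longrightarrow> card {y\<in>l. E x y} \<le> q + 1"
    using c2_ge
  proof (induction rule: inc_induct)
    case base
    then show ?case using tau_c2 by blast
  next
    case (step t)
    show ?case
    proof (intro allI impI, rule ccontr)
      fix x l assume x: "x \<in> V" "l \<in> L" "x \<notin> l" and "\<not> card {y\<in>l. E x y} \<le> t"
      then have T: "card {y\<in>l. E x y} = Suc t" using step.IH by (meson le_antisym not_less_eq_eq)
      have "card {y\<in>l. E x y} < card l" using size_gt_c2[OF x(2)] tau_c2[OF x] by simp
      then obtain y where y: "y \<in> l" "\<not> E x y"
        by (metis (mono_tags, lifting) Collect_cong Collect_mem_eq less_irrefl)
      obtain v where v: "v \<in> l" "E x v" using T by (metis (mono_tags, lifting) Collect_empty_eq card.empty nat.distinct(1))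
      have dxy: "d x y = 2" using nonadjacent_d2 x v y by blast
      have yV: "y \<in> V" using L_V x y by blast
      then have dyx: "d y x = 2" using dxy d_sym x by metis
      have p: "\<beta> + \<alpha> * (r - 1) - (real s - 1) * real t \<le> real (card m) - 1" if "m \<in> L" for m
        using size_lower[of "Suc t" m] step.IH that by simp
      have "(real t + 1) * (\<beta> + \<alpha> * (r - 1) - (real s - 1) * real t)
          = (\<Sum>m\<in>{m\<in>on x. m \<inter> l \<noteq> {}}. \<beta> + \<alpha> * (r - 1) - (real s - 1) * real t)"
        using card_meeting_lines[OF x] T by simp
      also have "\<dots> \<le> (\<Sum>m\<in>{m\<in>on x. m \<inter> l \<noteq> {}}. real (card m) - 1)"
        using p onD by (intro sum_mono) auto
      also have "\<dots> \<le> qn (d y x) * (\<beta> + \<alpha> * (r - qn (d y x)))"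
      proof (rule lines_within[OF x(1) yV])
        fix m z assume "m \<in> {m\<in>on x. m \<inter> l \<noteq> {}}" "z \<in> m"
        then show "d y z \<le> d y x" using meet_d[of l m] x(2) y(1) onD dyx by fastforce
      qed auto
      finally have F: "(real t + 1) * (\<beta> + \<alpha> * (r - 1) - (real s - 1) * real t)
          \<le> (real q + 1) * (\<beta> + \<alpha> * (r - (real q + 1)))"
        using dyx gnum_2[of q] by (simp add: add.commute)
      define A where "A = \<beta> + \<alpha> * (r - 1)"
      \<comment> \<open>Hypothesis (1) is exactly the failure of \<open>F\<close> at
        \<open>t = q + 1\<close>.\<close>
      have A: "(real q + 2) * A - (real s - 1) * ((real q + 2) * (real q + 1))
          > (real q + 1) * (\<beta> + \<alpha> * (r - (real q + 1)))"
        using h1 by (simp add: A_def algebra_simps)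
      \<comment> \<open>Larger \<open>t\<close> reduce to \<open>t = q + 1\<close>: the difference
        of the sides is \<open>(t - q - 1) (A - (s - 1) (t + q + 2))\<close>, and the lower bound on
        \<open>a_1\<close> makes the second factor nonnegative as long as
        \<open>t < c_2\<close>.\<close>
      have "(real t + 1) * A - (real s - 1) * ((real t + 1) * real t)
          \<ge> (real q + 2) * A - (real s - 1) * ((real q + 2) * (real q + 1))"
      proof (cases "t = q + 1")
        case False
        then have t: "q + 2 \<le> t" "t + 1 \<le> cs 2" using step.hyps by auto
        then have "real t + real q + 2 \<le> 2 * real (cs 2) - 2" by linarith
        then have "(real s - 1) * (real t + real q + 2) \<le> (real s - 1) * (2 * real (cs 2) - 2)"
          using s2 by (intro mult_left_mono) simp_all
        also have "\<dots> \<le> A" using a1_ge c2_ge unfolding A_def by (simp add: algebra_simps)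
        finally have "0 \<le> (real t - real q - 1) * (A - (real s - 1) * (real t + real q + 2))"
          using t by simp
        then show ?thesis by (simp add: algebra_simps)
      qed (simp add: add.commute)
      then show False using F A unfolding A_def by (simp add: algebra_simps)
    qed
  qed
  then show ?thesis using assms by blast
qed

lemma size_ge: "l \<in> L \<Longrightarrow> real (card l) - 1 \<ge> \<beta> + \<alpha> * (r - 1) - real q * (real s - 1)"
  using size_lower[of "q + 1" l] tau by (simp add: mult.commute)

text \<open>The extra \<open>q (s - q) + q^2 - q\<close> in hypothesis (3) equals the
  \<open>q (s - 1)\<close> lost in \<open>size_ge\<close>.\<close>

lemma size_gt: assumes "l \<in> L"
  shows "real (card l) - 1 > ((real q + 1) * (real q ^ 2 + real q + 1) - 2) * (real s - real q)"
  using size_ge[OF assms] h3 by (simp add: algebra_simps power2_eq_square)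

end

section \<open>Lines at distance two\<close>

context line_geometry
begin

definition near :: "'a \<Rightarrow> 'a set \<Rightarrow> bool" where "near x l \<longleftrightarrow> (\<forall>z\<in>l. d x z \<le> 2)"
definition close :: "'a set \<Rightarrow> 'a set \<Rightarrow> bool" where "close l m \<longleftrightarrow> (\<forall>y\<in>l. near y m)"
text \<open>For \<open>d x y = 2\<close> these sets will be the blocks of the linear space on the
  lines through \<open>x\<close>. \<open>Cl x l\<close> describes the same blocks by a line
  \<open>l\<close> near \<open>x\<close> and off it.\<close>

definition Qs :: "'a \<Rightarrow> 'a \<Rightarrow> 'a set set" where "Qs x y = {l\<in>on x. near y l}"
definition Cl :: "'a \<Rightarrow> 'a set \<Rightarrow> 'a set set" where "Cl x l = {m\<in>on x. close m l}"

lemma Qs_fin [simp]: "finite (Qs x y)" and Cl_fin [simp]: "finite (Cl x l)"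
  by (auto simp: Qs_def Cl_def)

lemma close_sym: assumes "l \<in> L" "m \<in> L" "close l m" shows "close m l"
  unfolding close_def near_def
proof (intro ballI)
  fix y z assume "y \<in> m" "z \<in> l"
  then show "d y z \<le> 2" using assms d_sym[of y z] L_V unfolding close_def near_def by auto
qed

lemma close_meet: assumes "l \<in> L" "m \<in> L" "v \<in> l" "v \<in> m" shows "close l m"
  unfolding close_def near_def using meet_d assms by blast

lemma near_nb: assumes "l \<in> L" "v \<in> l" "E y v" shows "near y l"
  unfolding near_def using line_d[OF assms(1,2)] d_E[OF assms(3)] E_V[OF assms(3)] by fastforce

lemma s_minus_q: "real s - real q \<ge> real q ^ 2 + 1"
  using s_ge' by simp

lemma qr: "real q \<ge> 2"
  using q2 by simp

lemma P_eq: "(real q + 1) * (real q ^ 2 + real q + 1) - 2 = real q ^ 3 + 2 * real q ^ 2 + 2 * real q - 1"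
  by (simp add: algebra_simps power2_eq_square power3_eq_cube)

lemma q_pow: "real q ^ 2 \<ge> 2 * real q" "real q ^ 3 \<ge> 2 * real q ^ 2"
  using qr by (auto simp: power2_eq_square power3_eq_cube intro: mult_right_mono)

lemma size_gt': "l \<in> L \<Longrightarrow>
    real (card l) > (real q ^ 3 + 2 * real q ^ 2 + 2 * real q - 1) * (real s - real q) + 1"
  using size_gt[of l] unfolding P_eq by simp

text \<open>A bound in \<open>q\<close> alone that covers two later exclusions from a line: the
  neighbours of \<open>c_2 \<le> (q + 1)^2\<close> vertices, and the neighbours of
  \<open>6 (q + 1)\<close> vertices together with one point.\<close>

lemma size_big: assumes "l \<in> L" shows "card l > (q + 1) ^ 3 + 6 * (q + 1) ^ 2 + 1"
proof -
  have "5 * (real q ^ 3 + 2 * real q ^ 2 + 2 * real q - 1)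
      \<le> (real s - real q) * (real q ^ 3 + 2 * real q ^ 2 + 2 * real q - 1)"
    using s_minus_q q_pow qr by (intro mult_right_mono) linarith+
  then have "5 * (real q ^ 3 + 2 * real q ^ 2 + 2 * real q - 1) + 1 < real (card l)"
    using size_gt'[OF assms] by (simp add: mult.commute)
  then have "real q ^ 3 + 9 * real q ^ 2 + 15 * real q + 8 < real (card l)"
    using q_pow qr by argo
  then have "real ((q + 1) ^ 3 + 6 * (q + 1) ^ 2 + 1) < real (card l)"
    by (simp add: algebra_simps power2_eq_square power3_eq_cube)
  then show ?thesis by (simp only: of_nat_less_iff)
qed

text \<open>Each vertex of \<open>F\<close> spoils at most \<open>q + 1\<close> points of
  \<open>l\<close>. The number \<open>6 (q + 1)\<close> allows three vertices for every line of two
  blocks.\<close>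

lemma generic_point:
  assumes l: "l \<in> L" and F: "finite F" "F \<subseteq> V" "F \<inter> l = {}" "card F \<le> 6 * (q + 1)"
  obtains z where "z \<in> l" "z \<noteq> x" "\<And>w. w \<in> F \<Longrightarrow> \<not> E w z"
proof -
  let ?B = "insert x (\<Union>w\<in>F. {z\<in>l. E w z})"
  have "card (\<Union>w\<in>F. {z\<in>l. E w z}) \<le> (\<Sum>w\<in>F. card {z\<in>l. E w z})"
    using F(1) by (rule card_UN_le)
  also have "\<dots> \<le> (\<Sum>w\<in>F. q + 1)" using tau l F by (intro sum_mono) blast
  also have "\<dots> \<le> 6 * (q + 1) * (q + 1)" using F(4) by (simp only: sum_constant of_nat_id mult_le_mono1)
  finally have c: "card (\<Union>w\<in>F. {z\<in>l. E w z}) \<le> 6 * (q + 1) ^ 2"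
    by (simp only: power2_eq_square mult.assoc)
  have fin: "finite (\<Union>w\<in>F. {z\<in>l. E w z})" using F(1) L_fin[OF l] by auto
  have "card ?B < card l" using size_big[OF l] c fin by (simp add: card_insert_if)
  then have "\<not> l \<subseteq> ?B" using fin card_mono[of ?B l] by auto
  then show ?thesis using that by blast
qed

section \<open>A uniform line size and blocks with q + 1 lines\<close>

definition X :: real where "X = \<beta> + \<alpha> * (r - 1) - real q * (real s - 1)"

lemma X_size: "l \<in> L \<Longrightarrow> X \<le> real (card l) - 1"
  using size_ge unfolding X_def .

lemma X_gt: "X > (real q ^ 3 + 2 * real q ^ 2 + 2 * real q - 1) * (real s - real q)"
  using h3 unfolding X_def P_eq[symmetric] by (simp add: algebra_simps power2_eq_square)

lemma X_pos: "X > 0"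
proof -
  have "(real q ^ 3 + 2 * real q ^ 2 + 2 * real q - 1) * (real s - real q) \<ge> 0"
    using s_minus_q q_pow qr by (intro mult_nonneg_nonneg) (linarith | simp add: add_nonneg_nonneg)+
  then show ?thesis using X_gt by linarith
qed

lemma card_lines_within:
  assumes "x \<in> V" "w \<in> V" "M \<subseteq> on x" "\<And>m z. m \<in> M \<Longrightarrow> z \<in> m \<Longrightarrow> d w z \<le> d w x"
  shows "real (card M) * X \<le> qn (d w x) * (\<beta> + \<alpha> * (r - qn (d w x)))"
proof -
  have "real (card M) * X = (\<Sum>m\<in>M. X)" by simp
  also have "\<dots> \<le> (\<Sum>m\<in>M. real (card m) - 1)" using X_size assms(3) onD by (intro sum_mono) blast
  also have "\<dots> \<le> qn (d w x) * (\<beta> + \<alpha> * (r - qn (d w x)))" using lines_within assms by blast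
  finally show ?thesis .
qed

text \<open>By (1), \<open>q + 2\<close> lines with at least \<open>X\<close> further points each do
  not fit among the neighbours of \<open>x\<close> within distance two of \<open>y\<close>.\<close>

lemma Qs_le: assumes "x \<in> V" "y \<in> V" "d x y = 2" shows "card (Qs x y) \<le> q + 1"
proof (rule ccontr)
  assume "\<not> card (Qs x y) \<le> q + 1"
  then have "real q + 2 \<le> real (card (Qs x y))" by linarith
  then have "(real q + 2) * X \<le> real (card (Qs x y)) * X" using X_pos by (intro mult_right_mono) auto
  also have "\<dots> \<le> qn (d y x) * (\<beta> + \<alpha> * (r - qn (d y x)))"
    using assms d_sym[of x y] by (intro card_lines_within) (auto simp: Qs_def near_def)
  also have "\<dots> = (real q + 1) * (\<beta> + \<alpha> * (r - (real q + 1)))"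
    using assms d_sym[of x y] gnum_2[of q] by (simp add: add.commute)
  finally have "(real q + 2) * X \<le> (real q + 1) * (\<beta> + \<alpha> * (r - (real q + 1)))" .
  moreover have "0 \<le> 2 * (real s - 1) + real q * (real s - 1)" using s2 by simp
  ultimately show False using h1 unfolding X_def by (simp add: algebra_simps)
qed

text \<open>The common neighbours of \<open>x\<close> and \<open>y\<close> lie on the at most
  \<open>q + 1\<close> lines of \<open>Qs x y\<close>, at most \<open>q + 1\<close> on each; hence
  \<open>c_2 \<le> (q + 1)^2\<close>.\<close>

lemma \<alpha>_le: "\<alpha> \<le> real q"
proof -
  obtain x y where xy: "x \<in> V" "y \<in> V" "d x y = 2" using d_attained[of 2] D3 by auto
  have "cs 2 = (\<Sum>l\<in>on x. card {z\<in>l - {x}. E y z})"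
    using common_nb[OF xy] card_nb_lines[OF xy(1)] by simp
  also have "\<dots> = (\<Sum>l\<in>Qs x y. card {z\<in>l - {x}. E y z})"
  proof (rule sum.mono_neutral_right)
    show "\<forall>l\<in>on x - Qs x y. card {z\<in>l - {x}. E y z} = 0"
      using near_nb onD by (fastforce simp: Qs_def)
  qed (auto simp: Qs_def)
  also have "\<dots> \<le> (\<Sum>l\<in>Qs x y. q + 1)"
  proof (rule sum_mono)
    fix l assume "l \<in> Qs x y"
    then have l: "l \<in> L" "x \<in> l" using onD by (auto simp: Qs_def)
    then have "y \<notin> l" using L_E[of l x y] xy d_E d_refl by fastforce
    then have "card {z\<in>l. E y z} \<le> q + 1" using tau xy l by blast
    moreover have "card {z\<in>l - {x}. E y z} \<le> card {z\<in>l. E y z}"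
      using L_fin[OF l(1)] by (intro card_mono) auto
    ultimately show "card {z\<in>l - {x}. E y z} \<le> q + 1" by simp
  qed
  also have "\<dots> \<le> (q + 1) * (q + 1)" using Qs_le[OF xy] by (simp only: sum_constant of_nat_id mult_le_mono1)
  finally have "real (cs 2) \<le> real ((q + 1) * (q + 1))" by (simp only: of_nat_le_iff)
  then have "(real q + 1) * (1 + \<alpha>) \<le> (real q + 1) * (real q + 1)"
    unfolding c2_eq by (simp add: algebra_simps)
  then show ?thesis by (simp add: mult_le_cancel_left_pos)
qed

lemma c2_le: "cs 2 \<le> (q + 1) ^ 2"
proof -
  have "(real q + 1) * (1 + \<alpha>) \<le> (real q + 1) * (real q + 1)"
    using \<alpha>_le by (intro mult_left_mono) auto
  then have "real (cs 2) \<le> real ((q + 1) ^ 2)" unfolding c2_eq by (simp add: power2_eq_square algebra_simps)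
  then show ?thesis by (simp only: of_nat_le_iff)
qed

text \<open>Each point of \<open>m\<close> at distance two from \<open>x\<close> has \<open>c\<^sub>2\<close> common neighbours with \<open>x\<close>. These lie
  among the \<open>c\<^sub>3\<close> neighbours of \<open>x\<close> at distance two from \<open>w\<close>, each of which has at most
  \<open>q + 1\<close> neighbours on \<open>m\<close>.\<close>

lemma card_d2_le: assumes "x \<in> V" "m \<in> L" "w \<in> m" "d x w = 3"
  shows "card {y\<in>m. d x y \<le> 2} \<le> q ^ 3 + q ^ 2 + 2 * q"
proof (rule ccontr)
  let ?Y = "{y\<in>m. d x y \<le> 2}" and ?Z = "{z. E x z \<and> d w z = 2}"
  have w: "w \<in> V" "d w x = 3" using assms L_V d_sym by auto
  have Z: "card ?Z = cs 3" using card_c[of w x 2] w assms(1) by (simp add: numeral_3_eq_3 numeral_2_eq_2)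
  have "cs 2 * card ?Y \<le> (q + 1) * card ?Z"
  proof (rule double_count[where R = E])
    show "finite ?Y" using L_fin assms by simp
  next
    fix y assume y: "y \<in> ?Y"
    then have yV: "y \<in> V" using assms L_V by auto
    have y2: "d x y = 2" using y line_d[OF assms(2) _ assms(3,1), of y] assms(4) by auto
    have dwy: "d w y \<le> 1" using line_d[OF assms(2,3) _ w(1), of y] y by auto
    have "{z. E x z \<and> E y z} \<subseteq> {z\<in>?Z. E y z}"
    proof
      fix z assume z: "z \<in> {z. E x z \<and> E y z}"
      then have "d w z \<le> 2" using d_tri_E[of y z w] dwy w by auto
      moreover have "d w x \<le> Suc (d w z)" using z d_tri_E[of z x w] w E_sym by auto
      ultimately show "z \<in> {z\<in>?Z. E y z}" using z w by auto
    qed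
    then have "card {z. E x z \<and> E y z} \<le> card {z\<in>?Z. E y z}" by (intro card_mono) auto
    then show "cs 2 \<le> card {z\<in>?Z. E y z}" using common_nb[OF assms(1) yV y2] by simp
  next
    fix z assume z: "z \<in> ?Z"
    then have "z \<notin> m" using line_d[OF assms(2,3) _ w(1), of z] by fastforce
    then have "card {y\<in>m. E z y} \<le> q + 1" using tau z assms E_V by blast
    moreover have "card {y\<in>?Y. E y z} \<le> card {y\<in>m. E z y}"
      using L_fin assms E_sym by (intro card_mono) auto
    ultimately show "card {y\<in>?Y. E y z} \<le> q + 1" by simp
  qed simp
  then have "real (cs 2 * card ?Y) \<le> real ((q + 1) * cs 3)" unfolding Z by (simp only: of_nat_le_iff)
  then have "(real q + 1) * ((1 + \<alpha>) * real (card ?Y))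
      \<le> (real q + 1) * ((real q ^ 2 + real q + 1) * (1 + \<alpha> * (real q + 1)))"
    by (simp add: c2_eq c3_eq algebra_simps)
  then have Y: "(1 + \<alpha>) * real (card ?Y) \<le> (real q ^ 2 + real q + 1) * (1 + \<alpha> * (real q + 1))"
    by (simp add: mult_le_cancel_left_pos)
  \<comment> \<open>The bound is the integer part of \<open>(q^2 + q + 1)^2 / (q + 1)\<close>, which
    is what the inequality \<open>Y\<close> gives in the extreme case \<alpha> = q.\<close>
  assume "\<not> card ?Y \<le> q ^ 3 + q ^ 2 + 2 * q"
  then have "real (q ^ 3 + q ^ 2 + 2 * q + 1) \<le> real (card ?Y)" by (simp only: of_nat_le_iff)
  then have "(1 + \<alpha>) * (real q ^ 3 + real q ^ 2 + 2 * real q + 1) \<le> (1 + \<alpha>) * real (card ?Y)"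
    using \<alpha>_nonneg by (intro mult_left_mono) (auto simp: add.commute)
  then have "(1 + \<alpha>) * (real q ^ 3 + real q ^ 2 + 2 * real q + 1)
      \<le> (real q ^ 2 + real q + 1) * (1 + \<alpha> * (real q + 1))" using Y by linarith
  then have "(real q + 1) * ((1 + \<alpha>) * (real q ^ 3 + real q ^ 2 + 2 * real q + 1))
      \<le> (real q + 1) * ((real q ^ 2 + real q + 1) * (1 + \<alpha> * (real q + 1)))"
    by (rule mult_left_mono) simp
  moreover have "(real q + 1) * ((1 + \<alpha>) * (real q ^ 3 + real q ^ 2 + 2 * real q + 1))
      = (real q + 1) * ((real q ^ 2 + real q + 1) * (1 + \<alpha> * (real q + 1)))
       + (real q ^ 2 + real q + 1) * (real q * (real q - \<alpha>)) + real q * (1 + \<alpha>)"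
    by (simp add: algebra_simps power2_eq_square power3_eq_cube)
  moreover have "0 \<le> (real q ^ 2 + real q + 1) * (real q * (real q - \<alpha>))"
    using \<alpha>_le by (intro mult_nonneg_nonneg add_nonneg_nonneg) auto
  moreover have "0 < real q * (1 + \<alpha>)" using \<alpha>_nonneg q2 by (intro mult_pos_pos) auto
  ultimately show False by linarith
qed

text \<open>With at most \<open>q\<close> lines in \<open>Qs x y\<close>, and at most
  \<open>K\<close> points within distance two of \<open>y\<close> on every other line, the
  \<open>k - b_2\<close> neighbours of \<open>x\<close> in that ball cannot be accommodated. This is
  where (2) enters.\<close>

lemma Qs_card: assumes "x \<in> V" "y \<in> V" "d x y = 2" shows "card (Qs x y) = q + 1"
proof (rule ccontr)
  assume "card (Qs x y) \<noteq> q + 1"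
  then have qle: "card (Qs x y) \<le> q" using Qs_le[OF assms] by simp
  define K where "K = real q ^ 3 + real q ^ 2 + 2 * real q"
  have yx: "d y x = 2" using assms d_sym by metis
  have K: "0 \<le> K" "K \<le> real q ^ 3 + 2 * real q ^ 2 + 2 * real q - 1"
    using qr q_pow by (simp_all add: K_def)
  have rest: "real (card {z\<in>l - {x}. d y z \<le> 2}) \<le> K" if l: "l \<in> on x - Qs x y" for l
  proof -
    have lL: "l \<in> L" "x \<in> l" "\<not> near y l" using l onD by (auto simp: Qs_def)
    then obtain w where w: "w \<in> l" "d y w > 2" by (auto simp: near_def)
    then have "d y w = 3" using line_d[OF lL(1,2) w(1) assms(2)] yx by simp
    then have "card {z\<in>l. d y z \<le> 2} \<le> q ^ 3 + q ^ 2 + 2 * q" using card_d2_le assms(2) lL w by blast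
    moreover have "card {z\<in>l - {x}. d y z \<le> 2} \<le> card {z\<in>l. d y z \<le> 2}"
      using L_fin[OF lL(1)] by (intro card_mono) auto
    ultimately have "real (card {z\<in>l - {x}. d y z \<le> 2}) \<le> real (q ^ 3 + q ^ 2 + 2 * q)"
      by linarith
    then show ?thesis by (simp add: K_def)
  qed
  have inn: "real (card {z\<in>l - {x}. d y z \<le> 2}) \<le> \<beta>" if l: "l \<in> on x" for l
  proof -
    have "card {z\<in>l - {x}. d y z \<le> 2} \<le> card (l - {x})"
      using L_fin onD l by (intro card_mono) auto
    then show ?thesis using card_minus[OF l] clique_bound[OF L_clique[OF onD(1)[OF l]]] by simp
  qed
  have \<beta>K: "K \<le> \<beta>"
  proof -
    obtain l where l: "l \<in> on x" using on_ge_r[OF assms(1)] r_pos by (cases "on x = {}") auto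
    then have "X \<le> \<beta>" using X_size[of l] clique_bound[OF L_clique] onD by fastforce
    moreover have "1 * (real q ^ 3 + 2 * real q ^ 2 + 2 * real q - 1)
        \<le> (real s - real q) * (real q ^ 3 + 2 * real q ^ 2 + 2 * real q - 1)"
      using s_minus_q q_pow qr by (intro mult_right_mono) linarith+
    ultimately show ?thesis using X_gt K by (simp add: mult.commute)
  qed
  have "(real q + 1) * (\<beta> + \<alpha> * (r - (real q + 1))) = real (card {z. E x z \<and> d y z \<le> 2})"
    using card_within[OF assms(2,1) D0] yx k_eq bn_eq[of 2] D3 gnum_2[of q] by (simp add: algebra_simps)
  also have "\<dots> = (\<Sum>l\<in>on x. real (card {z\<in>l - {x}. d y z \<le> 2}))"
    using card_nb_lines[OF assms(1)] by simp
  also have "\<dots> = (\<Sum>l\<in>on x - Qs x y. real (card {z\<in>l - {x}. d y z \<le> 2}))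
      + (\<Sum>l\<in>Qs x y. real (card {z\<in>l - {x}. d y z \<le> 2}))"
    by (rule sum.subset_diff) (auto simp: Qs_def)
  also have "\<dots> \<le> (\<Sum>l\<in>on x - Qs x y. K) + (\<Sum>l\<in>Qs x y. \<beta>)"
    using rest inn by (intro add_mono sum_mono) (auto simp: Qs_def)
  also have "\<dots> = (real (card (on x)) - real (card (Qs x y))) * K + real (card (Qs x y)) * \<beta>"
  proof -
    have "card (on x - Qs x y) = card (on x) - card (Qs x y)" "card (Qs x y) \<le> card (on x)"
      by (auto simp: Qs_def intro!: card_Diff_subset card_mono)
    then show ?thesis by (simp add: of_nat_diff)
  qed
  also have "\<dots> \<le> (real s - real (card (Qs x y))) * K + real (card (Qs x y)) * \<beta>"
    using on_card[OF assms(1)] K by (intro add_right_mono mult_right_mono) auto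
  \<comment> \<open>As \<open>K \<le> \<beta>\<close>, the bound grows with the number of lines in
    \<open>Qs x y\<close>.\<close>
  also have "\<dots> \<le> (real s - real q) * K + real q * \<beta>"
  proof -
    have "0 \<le> (real q - real (card (Qs x y))) * (\<beta> - K)"
      using qle \<beta>K by (intro mult_nonneg_nonneg) auto
    then show ?thesis by (simp add: algebra_simps)
  qed
  finally have "\<beta> + (real q + 1) * \<alpha> * (r - (real q + 1)) \<le> (real s - real q) * K"
    by (simp add: algebra_simps)
  also have "\<dots> \<le> (real s - real q) * (real q ^ 3 + 2 * real q ^ 2 + 2 * real q - 1)"
    using K s_minus_q zero_le_power2[of "real q"]
    by (intro mult_left_mono) linarith+
  finally show False using h2 unfolding P_eq
    by (simp add: algebra_simps power2_eq_square)
qed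

text \<open>\<open>Cl x l\<close> lies in \<open>Qs x y\<close>, so it suffices that it has
  \<open>q + 1\<close> members. Count pairs of a point \<open>v\<close> of \<open>l\<close> at
  distance two from \<open>x\<close> and a line of \<open>Qs x v\<close>: a line not close to
  \<open>l\<close> has a point at distance three from some point of \<open>l\<close>, and so occurs
  for at most \<open>K\<close> points \<open>v\<close>.\<close>

lemma Cl_eq_Qs: assumes "x \<in> V" "l \<in> L" "near x l" "x \<notin> l" "y \<in> l" "d x y = 2"
  shows "Cl x l = Qs x y"
proof (rule card_seteq)
  show "Cl x l \<subseteq> Qs x y"
    using close_sym[OF _ assms(2)] onD assms(5) by (fastforce simp: Cl_def Qs_def close_def)
next
  define W where "W = {v\<in>l. d x v = 2}"
  define K where "K = q ^ 3 + q ^ 2 + 2 * q"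
  have fl: "finite l" "finite W" using L_fin[OF assms(2)] by (auto simp: W_def)
  have "y \<in> V" using L_V assms by blast
  have "l = W \<union> {v\<in>l. E x v}"
  proof -
    have "d x v = 2 \<or> E x v" if "v \<in> l" for v
    proof -
      have "v \<in> V" "d x v \<le> 2" using that L_V assms by (auto simp: near_def)
      moreover have "d x v \<noteq> 0" using d_0[of x v] that assms calculation by auto
      moreover have "d x v = 1 \<longrightarrow> E x v" using d_1[of x v] calculation assms(1) by simp
      ultimately show ?thesis by linarith
    qed
    then show ?thesis by (auto simp: W_def)
  qed
  then have "card l \<le> card W + card {v\<in>l. E x v}" by (metis card_Un_le)
  then have Wl: "card l \<le> card W + (q + 1)" using tau[OF assms(1,2,4)] by simp
  show "card (Qs x y) \<le> card (Cl x l)"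
  proof (rule ccontr)
    assume "\<not> card (Qs x y) \<le> card (Cl x l)"
    then have e: "card (Cl x l) \<le> q" using Qs_card assms \<open>y \<in> V\<close> by simp
    have notcl: "card {v\<in>W. near v m} \<le> K" if m: "m \<in> on x - Cl x l" for m
    proof -
      have mL: "m \<in> L" "x \<in> m" "\<not> close m l" using m onD by (auto simp: Cl_def)
      then obtain u v where uv: "u \<in> m" "v \<in> l" "d u v > 2" by (auto simp: close_def near_def)
      have V: "u \<in> V" "v \<in> V" using uv L_V mL assms by auto
      have "d v u \<le> Suc (d v x)" using line_d[OF mL(1,2) uv(1) V(2)] .
      then have "d u v = 3" using uv V d_sym[of u v] d_sym[of x v] assms by (auto simp: near_def)
      then have "card {v\<in>l. d u v \<le> 2} \<le> K" using card_d2_le[OF V(1) assms(2) uv(2)] by (simp add: K_def)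
      moreover have "{v\<in>W. near v m} \<subseteq> {v\<in>l. d u v \<le> 2}"
      proof
        fix v' assume v': "v' \<in> {v\<in>W. near v m}"
        then have "v' \<in> V" using L_V[OF assms(2)] by (auto simp: W_def)
        then show "v' \<in> {v\<in>l. d u v \<le> 2}" using v' uv(1) d_sym[of u v'] V by (auto simp: W_def near_def)
      qed
      then have "card {v\<in>W. near v m} \<le> card {v\<in>l. d u v \<le> 2}" using fl by (intro card_mono) auto
      ultimately show ?thesis by simp
    qed
    have "(q + 1) * card W = (\<Sum>v\<in>W. card (Qs x v))"
    proof -
      have "card (Qs x v) = q + 1" if "v \<in> W" for v
        using that Qs_card[OF assms(1)] L_V[OF assms(2)] by (auto simp: W_def)
      then show ?thesis by simp
    qed
    also have "\<dots> = (\<Sum>v\<in>W. \<Sum>m\<in>{m\<in>on x. near v m}. 1)" by (simp add: Qs_def)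
    also have "\<dots> = (\<Sum>m\<in>on x. \<Sum>v\<in>{v\<in>W. near v m}. 1)"
      using fl by (intro sum.swap_restrict) auto
    also have "\<dots> = (\<Sum>m\<in>on x. card {v\<in>W. near v m})" by simp
    also have "\<dots> = (\<Sum>m\<in>on x - Cl x l. card {v\<in>W. near v m}) + (\<Sum>m\<in>Cl x l. card {v\<in>W. near v m})"
      by (rule sum.subset_diff) (auto simp: Cl_def)
    also have "\<dots> \<le> (\<Sum>m\<in>on x - Cl x l. K) + (\<Sum>m\<in>Cl x l. card W)"
      using notcl fl by (intro add_mono sum_mono card_mono) auto
    also have "\<dots> = (card (on x) - card (Cl x l)) * K + card (Cl x l) * card W"
      by (subst sum_constant, subst card_Diff_subset) (auto simp: Cl_def)
    also have "\<dots> \<le> (s - card (Cl x l)) * K + card (Cl x l) * card W"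
      using on_card[OF assms(1)] by (intro add_mono mult_right_mono diff_le_mono) auto
    finally have "real ((q + 1) * card W) \<le> real ((s - card (Cl x l)) * K + card (Cl x l) * card W)"
      by (simp only: of_nat_le_iff)
    moreover have "card (Cl x l) \<le> s" using e s_minus_q by (smt (verit) of_nat_le_iff zero_le_power2)
    then have "real (s - card (Cl x l)) = real s - real (card (Cl x l))"
      by (rule of_nat_diff)
    ultimately have F: "(real q + 1) * real (card W)
        \<le> (real s - real (card (Cl x l))) * real K + real (card (Cl x l)) * real (card W)"
      by (simp add: distrib_right)
    define t where "t = real s - real q"
    have 1: "(real q ^ 2 - 1) * (real q ^ 2 + 1) \<le> (real q ^ 2 - 1) * t"
      using s_minus_q q_pow qr unfolding t_def by (intro mult_left_mono) linarith+
    have "(real q ^ 2 - 1) * 4 \<le> (real q ^ 2 - 1) * (real q ^ 2 + 1)"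
      using q_pow qr by (intro mult_left_mono) linarith+
    moreover have "real q \<le> (real q ^ 2 - 1) * 4" using q_pow qr by argo
    \<comment> \<open>Up to \<open>q + 1\<close> points of \<open>l\<close> are neighbours of
      \<open>x\<close> and do not count in \<open>W\<close>; they are paid for by
      \<open>q^2 - 1\<close>, the coefficient in \<open>size_gt'\<close> minus
      \<open>K\<close>.\<close>
    ultimately have "real q \<le> (real q ^ 2 - 1) * t" using 1 by (meson order_trans)
    then have W: "real (card W) > real K * t"
      using size_gt'[OF assms(2)] Wl unfolding K_def t_def[symmetric] by (simp add: algebra_simps)
    have "real K * 1 \<le> real K * t" using s_minus_q q_pow qr unfolding t_def
      by (intro mult_left_mono) auto
    then have "0 \<le> (real q - real (card (Cl x l))) * (real (card W) - real K)"
      using e W by (intro mult_nonneg_nonneg) auto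
    then show False using F W unfolding t_def by (simp add: algebra_simps)
  qed
qed simp

end

section \<open>The linear space of lines on a point\<close>

context line_geometry
begin

lemma far_notin: "l \<in> L \<Longrightarrow> y \<in> l \<Longrightarrow> d x y = 2 \<Longrightarrow> x \<notin> l"
  using L_E[of l x y] d_E[of x y] by fastforce

lemma Qs_I: "l \<in> L \<Longrightarrow> x \<in> l \<Longrightarrow> near y l \<Longrightarrow> l \<in> Qs x y"
  by (simp add: Qs_def on_def)

lemma Qs_D: "l \<in> Qs x y \<Longrightarrow> l \<in> L" "l \<in> Qs x y \<Longrightarrow> x \<in> l" "l \<in> Qs x y \<Longrightarrow> near y l"
  by (auto simp: Qs_def on_def)

lemma Cl_I: "m \<in> L \<Longrightarrow> x \<in> m \<Longrightarrow> close m l \<Longrightarrow> m \<in> Cl x l"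
  by (simp add: Cl_def on_def)

lemma Cl_D: "m \<in> Cl x l \<Longrightarrow> m \<in> L" "m \<in> Cl x l \<Longrightarrow> x \<in> m" "m \<in> Cl x l \<Longrightarrow> close m l"
  by (auto simp: Cl_def on_def)

lemma d2I: assumes "x \<in> V" "y \<in> V" "d x y \<le> 2" "x \<noteq> y" "\<not> E x y" shows "d x y = 2"
proof -
  have "d x y \<noteq> 0" "d x y \<noteq> 1" using d_0 d_1 assms by auto
  then show ?thesis using assms(3) by linarith
qed

lemma d2_not_E: "d x y = 2 \<Longrightarrow> \<not> E x y" "d x y = 2 \<Longrightarrow> \<not> E y x" "d x y = 2 \<Longrightarrow> x \<noteq> y"
  using d_E E_sym by fastforce+

lemma near_d2: assumes "x \<in> V" "l \<in> L" "near x l" "x \<notin> l" "z \<in> l" "\<not> E x z" shows "d x z = 2"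
  using assms L_V by (intro d2I) (auto simp: near_def)

lemma line_nb: assumes "l \<in> L" "x \<in> l" "m \<in> L" "x \<in> m" "z \<in> m" "z \<noteq> x" shows "near z l"
  using near_nb[OF assms(1,2)] L_E[OF assms(3,5,4,6)] by blast

lemma Cl_point: assumes "x \<in> V" "l \<in> L" "near x l" "x \<notin> l"
  obtains y where "y \<in> l" "d x y = 2" "Cl x l = Qs x y"
proof -
  obtain y where y: "y \<in> l" "\<not> E x y" using generic_point[OF assms(2), of "{x}" x] assms by auto
  then have "d x y = 2" using near_d2 assms by blast
  then show ?thesis using that y Cl_eq_Qs assms by blast
qed

lemma Cl_card: assumes "x \<in> V" "l \<in> L" "near x l" "x \<notin> l" shows "card (Cl x l) = q + 1"
  using Cl_point[OF assms] Qs_card[OF assms(1)] L_V[OF assms(2)] by metis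

lemma Qs_Cl: assumes "x \<in> V" "e \<in> Qs y x" "w \<in> e" "d x w = 2" shows "Qs x w = Cl x e"
  using Cl_eq_Qs[OF assms(1) Qs_D(1)[OF assms(2)] Qs_D(3)[OF assms(2)]] assms
    far_notin[OF Qs_D(1)[OF assms(2)]] by blast

text \<open>The line \<open>e\<close> is near \<open>x\<close>, so all its points at distance two
  from \<open>x\<close> have the block \<open>Cl x e\<close>.\<close>

lemma Qs_along: assumes "x \<in> V" "d x y = 2" "e \<in> Qs y x" "w \<in> e" "d x w = 2"
  shows "Qs x w = Qs x y"
  using Qs_Cl[OF assms(1,3) assms(4,5)] Qs_Cl[OF assms(1,3) Qs_D(2)[OF assms(3)] assms(2)] by simp

text \<open>The block \<open>Qs x y\<close> equals \<open>Cl x e\<close> for every \<open>e\<close>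
  in the opposite block \<open>Qs y x\<close>.\<close>

lemma Qs_close: assumes "x \<in> V" "d x y = 2" "g \<in> Qs x y" "e \<in> Qs y x" shows "close g e"
  using Qs_Cl[OF assms(1,4) Qs_D(2)[OF assms(4)] assms(2)] assms(3) Cl_D(3) by blast

lemma d2_sym: "x \<in> V \<Longrightarrow> y \<in> V \<Longrightarrow> d x y = 2 \<Longrightarrow> d y x = 2"
  using d_sym by metis

text \<open>Moves the base vertex from \<open>x\<close> to \<open>z\<close>. The line
  \<open>e\<close> through \<open>w\<close> and \<open>a\<close> belongs to
  \<open>Qs w x = Qs w z\<close>, so each line of \<open>Qs z w\<close> is close to
  \<open>e\<close>, hence near \<open>a\<close>; and the block of \<open>a\<close> at
  \<open>z\<close> is \<open>Cl z l\<close>.\<close>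

lemma Qs_eq_Cl:
  assumes V: "x \<in> V" "w \<in> V" and xw: "d x w = 2" and l: "l \<in> Qs x w" and m: "m \<in> Qs x w"
    and a: "a \<in> l" "E w a" and z: "z \<in> m" and zw: "d z w = 2" and za: "d z a = 2"
  shows "Qs z w = Cl z l"
proof -
  have zV: "z \<in> V" and aV: "a \<in> V" using L_V Qs_D m z l a by blast+
  obtain e where e: "e \<in> L" "w \<in> e" "a \<in> e" using edge_line a by blast
  have ax: "a \<noteq> x" using a d2_not_E xw by blast
  then have "near x e" using line_nb[OF e(1,3), of l] l a Qs_D by blast
  then have "e \<in> Qs w x" using e Qs_I by blast
  moreover have "Qs w z = Qs w x"
    using Qs_along[OF V(2) d2_sym[OF V xw] m z d2_sym[OF zV V(2) zw]] .
  ultimately have ez: "e \<in> Qs w z" by simp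
  have "z \<noteq> x" using za l a L_E[of l x a] ax d2_not_E Qs_D by blast
  then have nz: "near z l" using line_nb[of l x m z] l m z Qs_D by blast
  have zl: "z \<notin> l" using far_notin[of l a z] l a za Qs_D by blast
  have Cl: "Cl z l = Qs z a" using Cl_eq_Qs[OF zV Qs_D(1)[OF l] nz zl a(1) za] .
  show ?thesis
  proof (rule card_subset_eq)
    show "Qs z w \<subseteq> Cl z l"
    proof
      fix g assume g: "g \<in> Qs z w"
      then have "close g e" using Qs_close[OF zV zw _ ez] by blast
      then have "near a g" using close_sym g e Qs_D by (meson close_def)
      then show "g \<in> Cl z l" unfolding Cl using g Qs_D Qs_I by blast
    qed
    show "card (Qs z w) = card (Cl z l)" using Qs_card Cl V zV aV zw za by simp
  qed simp
qed

section \<open>Two lines on a vertex lie in at most one block\<close>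

text \<open>Supplies the adjacency \<open>E w a\<close> required by \<open>Qs_eq_Cl\<close> without
  changing the block. If \<open>y\<close> has no neighbour on \<open>l\<close>, a common neighbour
  of \<open>y\<close> and \<open>a\<close> serves, once \<open>a\<close> is chosen adjacent to no
  common neighbour of \<open>x\<close> and \<open>y\<close>: this keeps \<open>w\<close> from being
  adjacent to \<open>x\<close>.\<close>

lemma Qs_shift:
  assumes V: "x \<in> V" "y \<in> V" and xy: "d x y = 2" and l: "l \<in> Qs x y"
  obtains w a e where "a \<in> l" "w \<in> V" "E w a" "d x w = 2" "e \<in> Qs y x" "w \<in> e"
proof (cases "\<exists>a\<in>l. E y a")
  case True
  have "card (Qs y x) \<noteq> 0" using Qs_card V d2_sym xy by simp
  then obtain e where "e \<in> Qs y x" by fastforce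
  then show ?thesis using that[of _ y] True V xy Qs_D by blast
next
  case False
  have lL: "l \<in> L" "x \<in> l" "near y l" using l Qs_D by auto
  have yl: "y \<notin> l" using far_notin[OF lL(1,2)] d2_sym V xy by blast
  let ?M = "{z. E x z \<and> E y z}"
  have "card (\<Union>z\<in>?M. {a\<in>l. E z a}) \<le> (\<Sum>z\<in>?M. card {a\<in>l. E z a})"
    by (rule card_UN_le) simp
  also have "\<dots> \<le> (\<Sum>z\<in>?M. q + 1)"
    using tau lL False E_V by (intro sum_mono) blast
  also have "\<dots> \<le> (q + 1) ^ 2 * (q + 1)" using common_nb[OF V xy] c2_le by (simp only: sum_constant of_nat_id mult_le_mono1)
  also have "\<dots> < card l" using size_big[OF lL(1)] by (simp add: power3_eq_cube power2_eq_square)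
  finally have "\<not> l \<subseteq> (\<Union>z\<in>?M. {a\<in>l. E z a})"
    using L_fin[OF lL(1)] card_mono[of "\<Union>z\<in>?M. {a\<in>l. E z a}" l] by auto
  then obtain a where a: "a \<in> l" "\<And>z. E x z \<Longrightarrow> E y z \<Longrightarrow> \<not> E z a" by blast
  have aV: "a \<in> V" using L_V lL a by blast
  have ya: "d y a = 2" using near_d2[OF V(2) lL(1,3) yl a(1)] False a by blast
  obtain w where w: "E y w" "E a w" using common_nb_ex[OF V(2) aV ya] by blast
  obtain e where e: "e \<in> L" "y \<in> e" "w \<in> e" using edge_line w by blast
  have "e \<in> Qs y a" using Qs_I e near_nb w by blast
  moreover have "Qs y a = Qs y x" using Qs_along[OF V(2) d2_sym[OF V xy] l a(1) ya] .
  ultimately have eQ: "e \<in> Qs y x" by simp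
  have "w \<noteq> x" using w d2_not_E xy by blast
  moreover have "\<not> E x w" using a(2) w E_sym by blast
  ultimately have "d x w = 2" using Qs_D(3)[OF eQ] e E_V w V by (intro d2I) (auto simp: near_def)
  then show ?thesis using that[of a w e] a w eQ e E_V E_sym by blast
qed

text \<open>\<open>F\<close> is \<open>{y, w, a}\<close> with \<open>w\<close> and \<open>a\<close>
  from \<open>Qs_shift\<close>. A \<open>z\<close> adjacent to none of them is at distance two from
  all three, and then the block of \<open>y\<close> at \<open>z\<close> is determined by
  \<open>l\<close>.\<close>

lemma Qs_generic:
  assumes V: "x \<in> V" "y \<in> V" and xy: "d x y = 2" and l: "l \<in> Qs x y"
  obtains F where "finite F" "card F \<le> 3" "F \<subseteq> V"
    "\<And>m. m \<in> Qs x y \<Longrightarrow> m \<noteq> l \<Longrightarrow> F \<inter> m = {}"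
    "\<And>m z. m \<in> Qs x y \<Longrightarrow> m \<noteq> l \<Longrightarrow> z \<in> m \<Longrightarrow> (\<And>w. w \<in> F \<Longrightarrow> \<not> E w z) \<Longrightarrow>
      d z y = 2 \<and> Qs z y = Cl z l"
proof -
  obtain w a e where a: "a \<in> l" and w: "w \<in> V" "E w a" "d x w = 2" and e: "e \<in> Qs y x" "w \<in> e"
    using Qs_shift[OF assms] by blast
  have lL: "l \<in> L" "x \<in> l" using l Qs_D by auto
  have aV: "a \<in> V" using a lL L_V by blast
  have ax: "a \<noteq> x" using w d2_not_E by blast
  have Qw: "Qs x w = Qs x y" using Qs_along[OF V(1) xy e w(3)] .
  show ?thesis
  proof (rule that[of "{y, w, a}"])
    show "card {y, w, a} \<le> 3" by (simp add: card_insert_if)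
    show "{y, w, a} \<subseteq> V" using V w aV by blast
  next
    fix m assume m: "m \<in> Qs x y" "m \<noteq> l"
    then have mL: "m \<in> L" "x \<in> m" using Qs_D by auto
    have am: "a \<notin> m" using two_points[OF lL(1) mL(1) lL(2) a mL(2)] ax m by blast
    show 1: "{y, w, a} \<inter> m = {}"
      using far_notin[OF mL] d2_sym[OF V xy] d2_sym[OF V(1) w(1,3)] am by blast
    fix z assume z: "z \<in> m" "\<And>u. u \<in> {y, w, a} \<Longrightarrow> \<not> E u z"
    have zV: "z \<in> V" using L_V mL z by blast
    have ne: "\<not> E z y" "\<not> E z w" "\<not> E z a" "z \<noteq> y" "z \<noteq> w" "z \<noteq> a"
      using z E_sym 1 by blast+
    have zy: "d z y = 2"
      using near_d2[OF V(2) mL(1) Qs_D(3)[OF m(1)] _ z(1)] 1 z d2_sym V zV by blast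
    have zw: "d z w = 2"
      using near_d2[OF w(1) mL(1) Qs_D(3) _ z(1)] m Qw 1 z d2_sym w zV by blast
    have "z \<noteq> x" using ne ax L_E lL a by blast
    then have "near z l" using line_nb[OF lL mL z(1)] by blast
    then have za: "d z a = 2" using ne a aV zV by (intro d2I) (auto simp: near_def)
    have "Qs z w = Cl z l"
      using Qs_eq_Cl[OF V(1) w(1,3) _ _ a w(2) z(1) zw za] Qw l m by simp
    moreover have "Qs z w = Qs z y"
    proof -
      have "Qs y z = Qs y x" using Qs_along[OF V(2) d2_sym[OF V xy] m(1) z(1) d2_sym[OF zV V(2) zy]] .
      then show ?thesis using Qs_along[OF zV zy _ e(2) zw] e by simp
    qed
    ultimately show "d z y = 2 \<and> Qs z y = Cl z l" using zy by simp
  qed simp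
qed

text \<open>At a generic \<open>z\<close> on \<open>m\<close> the blocks of \<open>y\<close> and
  \<open>y'\<close> are both \<open>Cl z l\<close>. A line \<open>g \<noteq> m\<close> of that block
  is close to every line of both blocks at \<open>x\<close>, so both equal
  \<open>Cl x g\<close>.\<close>

lemma Qs_unique:
  assumes V: "x \<in> V" "y \<in> V" "y' \<in> V" and xy: "d x y = 2" "d x y' = 2"
    and l: "l \<in> Qs x y" "l \<in> Qs x y'" and m: "m \<in> Qs x y" "m \<in> Qs x y'" and lm: "l \<noteq> m"
  shows "Qs x y = Qs x y'"
proof -
  define A where "A w h F \<longleftrightarrow> finite F \<and> card F \<le> 3 \<and> F \<subseteq> V \<and> F \<inter> m = {} \<and>
    (\<forall>z\<in>m. (\<forall>u\<in>F. \<not> E u z) \<longrightarrow> d z w = 2 \<and> Qs z w = Cl z h)" for w h F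
  have "\<exists>F. A w h F" if "w \<in> V" "d x w = 2" "m \<in> Qs x w" "h \<in> Qs x w - {m}" for w h
    using Qs_generic[OF V(1) that(1,2), of h] that(3,4) unfolding A_def by (metis DiffD1 DiffD2 singletonI)
  then obtain F where F: "\<And>w h. w \<in> V \<Longrightarrow> d x w = 2 \<Longrightarrow> m \<in> Qs x w \<Longrightarrow> h \<in> Qs x w - {m} \<Longrightarrow> A w h (F w h)"
    by metis
  define G where "G w = (\<Union>h\<in>Qs x w - {m}. F w h)" for w
  have G: "finite (G w)" "card (G w) \<le> 3 * (q + 1)" "G w \<subseteq> V" "G w \<inter> m = {}"
    if w: "w \<in> V" "d x w = 2" "m \<in> Qs x w" for w
  proof -
    have *: "finite (F w h) \<and> F w h \<subseteq> V \<and> F w h \<inter> m = {}" if "h \<in> Qs x w - {m}" for h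
      using F[OF w that] unfolding A_def by blast
    show "finite (G w)" unfolding G_def using * by (intro finite_UN_I) auto
    have "p \<in> V \<and> p \<notin> m" if p: "p \<in> G w" for p
    proof -
      obtain h where "h \<in> Qs x w - {m}" "p \<in> F w h" using p unfolding G_def by blast
      then show ?thesis using *[of h] by blast
    qed
    then show "G w \<subseteq> V" "G w \<inter> m = {}" by blast+
    have "card (G w) \<le> (\<Sum>h\<in>Qs x w - {m}. card (F w h))" unfolding G_def by (rule card_UN_le) simp
    also have "\<dots> \<le> (\<Sum>h\<in>Qs x w - {m}. 3)" using F[OF w] unfolding A_def by (intro sum_mono) blast
    also have "\<dots> \<le> 3 * (q + 1)" using Qs_card[OF V(1) w(1,2)] w(3) by simp
    finally show "card (G w) \<le> 3 * (q + 1)" .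
  qed
  have "finite (G y \<union> G y')" "G y \<union> G y' \<subseteq> V" "(G y \<union> G y') \<inter> m = {}" "card (G y \<union> G y') \<le> 6 * (q + 1)"
    using G[OF V(2) xy(1) m(1)] G[OF V(3) xy(2) m(2)] card_Un_le[of "G y" "G y'"] by auto
  then obtain z where z: "z \<in> m" "z \<noteq> x" "\<And>w. w \<in> G y \<union> G y' \<Longrightarrow> \<not> E w z"
    using generic_point[OF Qs_D(1)[OF m(1)], of "G y \<union> G y'" x] by metis
  have mL: "m \<in> L" "x \<in> m" using m Qs_D by auto
  have zV: "z \<in> V" using z mL L_V by blast
  have C: "d z y = 2" "Qs z y = Cl z h" if "h \<in> Qs x y - {m}" for h
    using F[OF V(2) xy(1) m(1) that] z that unfolding A_def G_def by blast+
  have C': "Qs z y' = Cl z h" if "h \<in> Qs x y' - {m}" for h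
    using F[OF V(3) xy(2) m(2) that] z that unfolding A_def G_def by blast
  have zz: "Qs z y' = Qs z y" using C(2)[of l] C'[of l] l lm by simp
  have "card (Qs z y) = q + 1" using Qs_card[OF zV V(2)] C(1)[of l] l lm by blast
  then have "\<not> Qs z y \<subseteq> {m}" using q2 card_mono[of "{m}" "Qs z y"] by auto
  then obtain g where g: "g \<in> Qs z y" "g \<noteq> m" by blast
  have gL: "g \<in> L" "z \<in> g" using g Qs_D by auto
  have xg: "x \<notin> g" using two_points[OF gL(1) mL(1) _ gL(2) mL(2) z(1)] z(2) g(2) by blast
  have ng: "near x g" using line_nb[OF gL mL(1) z(1) mL(2)] z(2) by blast
  have sub: "Qs x w \<subseteq> Cl x g" if w: "\<And>h. h \<in> Qs x w - {m} \<Longrightarrow> Qs z y = Cl z h" for w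
  proof
    fix h assume h: "h \<in> Qs x w"
    show "h \<in> Cl x g"
    proof (cases "h = m")
      case True
      then show ?thesis using Cl_I[OF mL] close_meet[OF mL(1) gL(1) z(1) gL(2)] by simp
    next
      case False
      then have "close g h" using w[of h] h g Cl_D by auto
      then show ?thesis using close_sym[OF gL(1)] h Qs_D Cl_I by blast
    qed
  qed
  have "Qs x y = Cl x g"
    using sub[of y] C(2) Qs_card[OF V(1,2) xy(1)] Cl_card[OF V(1) gL(1) ng xg]
    by (intro card_subset_eq) auto
  moreover have "Qs x y' = Cl x g"
    using sub[of y'] C' zz Qs_card[OF V(1,3) xy(2)] Cl_card[OF V(1) gL(1) ng xg]
    by (intro card_subset_eq) auto
  ultimately show ?thesis by simp
qed

end

section \<open>Linear spaces with the Veblen property\<close>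

locale linear_space =
  fixes N :: "'p set" and J :: "'p \<Rightarrow> 'p \<Rightarrow> 'p set" and q :: nat
  assumes finN: "finite N"
    and J_in: "a \<in> N \<Longrightarrow> b \<in> N \<Longrightarrow> a \<noteq> b \<Longrightarrow> a \<in> J a b \<and> b \<in> J a b \<and> J a b \<subseteq> N"
    and J_card: "a \<in> N \<Longrightarrow> b \<in> N \<Longrightarrow> a \<noteq> b \<Longrightarrow> card (J a b) = q + 1"
    and J_eq: "a \<in> N \<Longrightarrow> b \<in> N \<Longrightarrow> a \<noteq> b \<Longrightarrow> c \<in> J a b \<Longrightarrow> e \<in> J a b \<Longrightarrow> c \<noteq> e \<Longrightarrow> J c e = J a b"
begin

definition subsp :: "'p set \<Rightarrow> bool" where
  "subsp S \<longleftrightarrow> S \<subseteq> N \<and> (\<forall>a\<in>S. \<forall>b\<in>S. a \<noteq> b \<longrightarrow> J a b \<subseteq> S)"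

lemma J_commute: "a \<in> N \<Longrightarrow> b \<in> N \<Longrightarrow> a \<noteq> b \<Longrightarrow> J a b = J b a"
  using J_eq[of a b b a] J_in by metis

lemma J_shift: "a \<in> N \<Longrightarrow> b \<in> N \<Longrightarrow> a \<noteq> b \<Longrightarrow> c \<in> J a b \<Longrightarrow> c \<noteq> a \<Longrightarrow> J a c = J a b"
  using J_eq J_in by metis

definition cone :: "'p \<Rightarrow> 'p set \<Rightarrow> 'p set" where "cone p S = (\<Union>c\<in>S. J p c)"

context
  fixes S p assumes S: "subsp S" "S \<noteq> {}" and p: "p \<in> N" "p \<notin> S"
begin

lemma S_N: "c \<in> S \<Longrightarrow> c \<in> N"
  using S by (auto simp: subsp_def)

lemma S_J: "a \<in> S \<Longrightarrow> b \<in> S \<Longrightarrow> a \<noteq> b \<Longrightarrow> J a b \<subseteq> S"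
  using S by (auto simp: subsp_def)

lemma cone_N: "cone p S \<subseteq> N"
  using J_in S_N p unfolding cone_def by blast

lemma S_cone: "S \<subseteq> cone p S"
  using J_in S_N p unfolding cone_def by blast

lemma p_cone: "p \<in> cone p S"
  using J_in S_N p S(2) unfolding cone_def by blast

lemma coneI: assumes "w \<in> N" "w \<noteq> p" "c \<in> J p w" "c \<in> S" shows "w \<in> cone p S"
proof -
  have "J p c = J p w" using J_shift[OF p(1) assms(1)] assms p by blast
  then show ?thesis using J_in[OF p(1) assms(1)] assms unfolding cone_def by blast
qed

text \<open>Each block joining \<open>p\<close> to \<open>S\<close> has a single point in
  \<open>S\<close>, since a second one would put \<open>p\<close> into the subspace; and distinct
  blocks through \<open>p\<close> share only \<open>p\<close>.\<close>

lemma cone_card: "card (cone p S) = 1 + q * card S"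
proof -
  have fS: "finite S" using finite_subset[OF _ finN] S_N by blast
  have fJ: "finite (J p c)" if "c \<in> S" for c
    using J_in[OF p(1) S_N[OF that]] p that finite_subset[OF _ finN] by blast
  have "cone p S = insert p (\<Union>c\<in>S. J p c - {p})"
    using p_cone unfolding cone_def by blast
  moreover have "card (\<Union>c\<in>S. J p c - {p}) = (\<Sum>c\<in>S. card (J p c - {p}))"
  proof (rule card_UN_disjoint[OF fS])
    show "\<forall>i\<in>S. \<forall>j\<in>S. i \<noteq> j \<longrightarrow> (J p i - {p}) \<inter> (J p j - {p}) = {}"
    proof (intro ballI impI, rule ccontr)
      fix i j assume ij: "i \<in> S" "j \<in> S" "i \<noteq> j" and "(J p i - {p}) \<inter> (J p j - {p}) \<noteq> {}"
      then obtain z where z: "z \<in> J p i" "z \<in> J p j" "z \<noteq> p" by blast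
      have N: "i \<in> N" "j \<in> N" "i \<noteq> p" "j \<noteq> p" using ij S_N p by auto
      have "J p z = J p i" "J p z = J p j" using J_shift[OF p(1)] z N by metis+
      then have "j \<in> J p i" "i \<in> J p i" using J_in[OF p(1)] N by metis+
      then have "J i j = J p i" using J_eq[OF p(1) N(1)] N ij by metis
      then have "p \<in> J i j" using J_in[OF p(1) N(1)] N by metis
      then show False using S_J ij p by blast
    qed
  qed (use fJ in auto)
  moreover have "(\<Sum>c\<in>S. card (J p c - {p})) = (\<Sum>c\<in>S. q)"
  proof (rule sum.cong[OF refl])
    fix c assume c: "c \<in> S"
    then have "p \<noteq> c" using p by blast
    then show "card (J p c - {p}) = q"
      using J_card[OF p(1) S_N[OF c]] J_in[OF p(1) S_N[OF c]] by simp
  qed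
  ultimately show ?thesis using fS fJ by (simp add: mult.commute card.insert_remove)
qed

end

end

locale veblen_space = linear_space +
  assumes veblen: "h \<in> N \<Longrightarrow> a \<in> N \<Longrightarrow> c \<in> N \<Longrightarrow> a \<noteq> h \<Longrightarrow> c \<noteq> h \<Longrightarrow> c \<notin> J h a \<Longrightarrow>
      a' \<in> J h a \<Longrightarrow> a' \<noteq> h \<Longrightarrow> c' \<in> J h c \<Longrightarrow> c' \<noteq> h \<Longrightarrow> J a c \<inter> J a' c' \<noteq> {}"
begin

context
  fixes S p assumes S: "subsp S" "S \<noteq> {}" and p: "p \<in> N" "p \<notin> S"
begin

lemmas S_N' = S_N[OF S p]
lemmas S_J' = S_J[OF S p]
lemmas cone_N' = cone_N[OF S p]
lemmas S_cone' = S_cone[OF S p]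
lemmas coneI' = coneI[OF S p]

text \<open>Veblen's axiom twice. With apex \<open>p\<close>, the block of \<open>u\<close> and
  \<open>v\<close> meets that of \<open>u0\<close> and \<open>v0\<close> in a point \<open>c\<close>
  of \<open>S\<close>; with apex \<open>u\<close>, the block of \<open>p\<close> and
  \<open>w\<close> meets that of \<open>u0\<close> and \<open>c\<close>, which lies in
  \<open>S\<close>. The second configuration needs \<open>u \<noteq> u0\<close>.\<close>

lemma cone_meet:
  assumes u0: "u0 \<in> S" and v0: "v0 \<in> S" and u: "u \<in> J p u0" "u \<noteq> p" and v: "v \<in> J p v0" "v \<noteq> p"
    and uv: "v \<notin> J p u" and w: "w \<in> J u v" and uu0: "u \<noteq> u0"
  shows "w \<in> cone p S"
proof -
  have N: "u0 \<in> N" "v0 \<in> N" "u0 \<noteq> p" "v0 \<noteq> p" using u0 v0 S_N' p by auto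
  then have uN: "u \<in> N" and vN: "v \<in> N" using u v J_in p by blast+
  have Ju: "J p u0 = J p u" using J_shift[OF p(1) N(1)] u N by metis
  have Jv: "J p v0 = J p v" using J_shift[OF p(1) N(2)] v N by metis
  have u0u: "u0 \<in> J p u" using Ju J_in p N by metis
  have v0v: "v0 \<in> J p v" using Jv J_in p N by metis
  have unv: "u \<noteq> v" using uv J_in p uN u by blast
  have uv0: "u0 \<noteq> v0" using Ju Jv uv J_in[of p v] p vN v by metis
  obtain c where c: "c \<in> J u v" "c \<in> J u0 v0"
    using veblen[OF p(1) uN vN u(2) v(2) uv u0u N(3) v0v N(4)] by blast
  have cS: "c \<in> S" using S_J'[OF u0 v0 uv0] c by blast
  have wN: "w \<in> N" using J_in[OF uN vN unv] w by blast
  have pu: "p \<in> J u p" "J u p = J p u" using J_in[OF uN p(1)] J_commute[OF uN p(1)] u by auto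
  show ?thesis
  proof (cases "w = c \<or> w = u")
    case True
    then show ?thesis using cS S_cone' u u0 unfolding cone_def by blast
  next
    case False
    have Jw: "J u w = J u v" using J_shift[OF uN vN unv w] False by blast
    have wup: "w \<notin> J u p"
    proof
      assume "w \<in> J u p"
      then have "J u w = J u p" using J_shift[OF uN p(1)] u False by blast
      then show False using Jw J_in[OF uN vN unv] pu uv by blast
    qed
    have cu: "c \<noteq> u"
    proof
      assume "c = u"
      then have "J u u0 \<subseteq> S" using S_J' cS u0 uu0 by blast
      moreover have "J u u0 = J u p" using J_shift[OF uN p(1)] u u0u pu uu0 by metis
      ultimately show False using pu p by blast
    qed
    have cu0: "c \<noteq> u0"
    proof
      assume "c = u0"
      then have "J u u0 = J u v" using J_shift[OF uN vN unv] c uu0 by metis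
      moreover have "J u u0 = J u p" using J_shift[OF uN p(1)] u u0u pu uu0 by metis
      ultimately show False using J_in[OF uN vN unv] pu uv by blast
    qed
    have wp: "w \<noteq> p" using wup pu by blast
    have "J p w \<inter> J u0 c \<noteq> {}"
      using veblen[OF uN p(1) wN _ _ wup, of u0 c] u u0u pu uu0 cu c Jw False by auto
    then obtain e where "e \<in> J p w" "e \<in> J u0 c" by blast
    then show ?thesis using coneI'[OF wN wp] S_J'[OF u0 cS] cu0 by blast
  qed
qed

lemma cone_subsp: "subsp (cone p S)"
proof -
  have "J u v \<subseteq> cone p S" if uv: "u \<in> cone p S" "v \<in> cone p S" "u \<noteq> v" for u v
  proof -
    have N: "u \<in> N" "v \<in> N" using uv cone_N' by auto
    obtain u0 v0 where u0: "u0 \<in> S" "u \<in> J p u0" and v0: "v0 \<in> S" "v \<in> J p v0"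
      using uv unfolding cone_def by blast
    have sub: "J p z \<subseteq> cone p S" if z: "z \<in> J p c" "c \<in> S" "z \<noteq> p" for z c
    proof -
      have "J p z = J p c" using J_shift[OF p(1) S_N'[OF z(2)]] z p by metis
      then show ?thesis using z unfolding cone_def by blast
    qed
    consider "u = p" | "v = p" | "u \<noteq> p" "v \<noteq> p" "v \<in> J p u" | "u \<noteq> p" "v \<noteq> p" "v \<notin> J p u"
      by blast
    then show ?thesis
    proof cases
      case 1
      then show ?thesis using sub[OF v0(2,1)] uv by blast
    next
      case 2
      then show ?thesis using sub[OF u0(2,1)] uv J_commute[OF N uv(3)] by simp
    next
      case 3
      then have "J u v = J p u" using J_eq[OF p(1) N(1)] J_in[OF p(1) N(1)] uv(3) by metis
      then show ?thesis using sub[OF u0(2,1) 3(1)] by simp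
    next
      case 4
      have swap: "u \<notin> J p v"
      proof
        assume "u \<in> J p v"
        then have "J p u = J p v" using J_shift[OF p(1) N(2)] 4 by metis
        then show False using 4 J_in[OF p(1) N(2)] by metis
      qed
      \<comment> \<open>By symmetry \<open>v \<noteq> v0\<close> serves \<open>cone_meet\<close> as
        well; otherwise both points lie in \<open>S\<close>.\<close>
      consider "u \<noteq> u0" | "v \<noteq> v0" | "u = u0" "v = v0" by blast
      then show ?thesis
      proof cases
        case 1
        then show ?thesis using cone_meet[OF u0(1) v0(1) u0(2) 4(1) v0(2) 4(2,3)] by blast
      next
        case 2
        then show ?thesis using cone_meet[OF v0(1) u0(1) v0(2) 4(2) u0(2) 4(1) swap]
          J_commute[OF N uv(3)] by blast
      next
        case 3
        then show ?thesis using S_J'[of u v] u0 v0 uv S_cone' by blast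
      qed
    qed
  qed
  then show ?thesis unfolding subsp_def using cone_N' by blast
qed

end

text \<open>Cones are formed repeatedly, starting from a point, until everything is covered; each
  one advances the Gaussian number by \<open>gnum_Suc\<close>.\<close>

lemma card_gnum: assumes "N \<noteq> {}" obtains i where "card N = gnum q i"
proof -
  have "\<exists>j. card N = gnum q j" if "subsp S" "S \<noteq> {}" "card S = gnum q i" for S i
    using that
  proof (induction "card (N - S)" arbitrary: S i rule: less_induct)
    case less
    show ?case
    proof (cases "S = N")
      case True
      then show ?thesis using less by blast
    next
      case False
      then obtain p where p: "p \<in> N" "p \<notin> S" using less.prems by (auto simp: subsp_def)
      note c = less.prems(1,2) p
      have "N - cone p S \<subset> N - S" using S_cone[OF c] p_cone[OF c] p by blast
      then have "card (N - cone p S) < card (N - S)" using finN by (intro psubset_card_mono) auto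
      then show ?thesis
        using less.hyps[OF _ cone_subsp[OF c], of "Suc i"] p_cone[OF c] cone_card[OF c] less.prems(3)
        by (auto simp: gnum_Suc)
    qed
  qed
  moreover obtain a where "a \<in> N" using assms by blast
  then have "subsp {a}" "card {a} = gnum q (Suc 0)" by (auto simp: subsp_def)
  ultimately show ?thesis using that by blast
qed

end

section \<open>The lines on a point form a projective space\<close>

context line_geometry
begin

text \<open>A point of \<open>l\<close> adjacent to a point of \<open>m\<close> yields a line missing \<open>x\<close>. Otherwise, if the
  conclusion fails, the second common neighbour of \<open>v \<in> l\<close> and \<open>v' \<in> m\<close> is adjacent to \<open>x\<close>, and
  there are too few common neighbours of \<open>x\<close> and \<open>v\<close> off \<open>l\<close> to serve all \<open>v'\<close>.\<close>

lemma apex_exists: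
  assumes x: "x \<in> V" and l: "l \<in> on x" and m: "m \<in> on x" and lm: "l \<noteq> m"
  obtains y v v' where "y \<in> V" "d x y = 2" "v \<in> l" "v' \<in> m" "E y v" "E y v'"
proof -
  have lL: "l \<in> L" "x \<in> l" and mL: "m \<in> L" "x \<in> m" using l m onD by auto
  show ?thesis
  proof (cases "\<exists>v\<in>l - {x}. \<exists>z\<in>m - {x}. E v z")
    case True
    then obtain v z where vz: "v \<in> l" "v \<noteq> x" "z \<in> m" "z \<noteq> x" "E v z" by blast
    obtain g where g: "g \<in> L" "v \<in> g" "z \<in> g" using edge_line vz by blast
    have xg: "x \<notin> g"
      using two_points[OF lL(1) g(1) lL(2) vz(1) _ g(2)] two_points[OF mL(1) g(1) mL(2) vz(3) _ g(3)] vz lm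
      by blast
    have xv: "E x v" "E x z" using L_E lL mL vz by blast+
    obtain y where y: "y \<in> g" "\<not> E x y" using generic_point[OF g(1), of "{x}" x] x xg by auto
    have "d x y = 2" using nonadjacent_d2[OF x g(1,2) xv(1) xg y] .
    moreover have "E y v" "E y z" using L_E[OF g(1) y(1)] g xv y by blast+
    ultimately show ?thesis using that[of y v z] vz L_V[OF g(1) y(1)] by blast
  next
    case no_edge: False
    obtain v where v: "v \<in> l" "v \<noteq> x" using generic_point[OF lL(1), of "{}" x] by auto
    have xv: "E x v" using L_E lL v by blast
    have vV: "v \<in> V" using L_V lL v by blast
    have vm: "v \<notin> m" using two_points[OF lL(1) mL(1) lL(2) v(1) mL(2)] v lm by blast
    let ?Z = "{z. E x z \<and> E v z \<and> z \<notin> l}" and ?A = "m - {x}"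
    show ?thesis
    proof (rule ccontr)
      assume "\<not> thesis"
      then have no: "\<And>y v'. E y v \<Longrightarrow> v' \<in> m \<Longrightarrow> E y v' \<Longrightarrow> d x y \<noteq> 2"
        using that v E_V by blast
      have AZ: "1 * card ?A \<le> (q + 1) * card ?Z"
      proof (rule double_count[where R = E])
        show "finite ?A" using L_fin mL by blast
      next
        fix a assume a: "a \<in> ?A"
        then have aV: "a \<in> V" and nva: "\<not> E v a" using L_V mL no_edge v by blast+
        have va: "d v a = 2" using nonadjacent_d2[OF vV mL(1,2) E_sym[OF xv] vm] a nva by blast
        have "card {z. E v z \<and> E a z} = cs 2" using common_nb[OF vV aV va] .
        then have "\<not> {z. E v z \<and> E a z} \<subseteq> {x}"
          using c2_ge q2 card_mono[of "{x}" "{z. E v z \<and> E a z}"] by auto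
        then obtain z where z: "E v z" "E a z" "z \<noteq> x" by blast
        have "d x z \<noteq> 2" using no z a E_sym by blast
        moreover have "d x z \<le> 2" using d_tri_E[OF z(1) x] d_E[OF xv] by simp
        ultimately have "E x z" using d2I[OF x] z E_V by blast
        moreover have "z \<notin> l" using no_edge z a E_sym by blast
        ultimately have "z \<in> {b\<in>?Z. E a b}" using z by blast
        moreover have "finite {b\<in>?Z. E a b}" by simp
        ultimately show "1 \<le> card {b\<in>?Z. E a b}" by (metis One_nat_def Suc_leI card_gt_0_iff empty_iff)
      next
        fix z assume z: "z \<in> ?Z"
        then have "z \<notin> m" using no_edge v by fastforce
        then have "card {a\<in>m. E z a} \<le> q + 1" using tau z mL E_V by blast
        moreover have "card {a\<in>?A. E a z} \<le> card {a\<in>m. E z a}"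
          using L_fin mL E_sym by (intro card_mono) auto
        ultimately show "card {a\<in>?A. E a z} \<le> q + 1" by simp
      qed simp
      \<comment> \<open>Each of the at most \<open>s - 1\<close> other lines on \<open>x\<close> has
        at most \<open>q + 1\<close> neighbours of \<open>v\<close>, and \<open>x\<close> is one of
        them.\<close>
      have cZ: "card ?Z \<le> (s - 1) * q"
      proof -
        have "card ?Z = (\<Sum>n\<in>on x. card {z\<in>n - {x}. E v z \<and> z \<notin> l})"
          using card_nb_lines[OF x] by simp
        also have "\<dots> = card {z\<in>l - {x}. E v z \<and> z \<notin> l} + (\<Sum>n\<in>on x - {l}. card {z\<in>n - {x}. E v z \<and> z \<notin> l})"
          using l by (intro sum.remove) auto
        also have "card {z\<in>l - {x}. E v z \<and> z \<notin> l} = 0"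
          by (metis (mono_tags, lifting) Collect_empty_eq DiffD1 card.empty)
        also have "(\<Sum>n\<in>on x - {l}. card {z\<in>n - {x}. E v z \<and> z \<notin> l}) \<le> (\<Sum>n\<in>on x - {l}. q)"
        proof (rule sum_mono)
          fix n assume n: "n \<in> on x - {l}"
          then have nL: "n \<in> L" "x \<in> n" using onD by auto
          then have vn: "v \<notin> n" using two_points[OF lL(1) nL(1) lL(2) v(1) nL(2)] v n by blast
          have "insert x {z\<in>n - {x}. E v z \<and> z \<notin> l} \<subseteq> {z\<in>n. E v z}" using nL xv E_sym by blast
          then have "card (insert x {z\<in>n - {x}. E v z \<and> z \<notin> l}) \<le> card {z\<in>n. E v z}"
            using L_fin nL by (intro card_mono) auto
          then have "Suc (card {z\<in>n - {x}. E v z \<and> z \<notin> l}) \<le> card {z\<in>n. E v z}"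
            using L_fin[OF nL(1)] by simp
          then show "card {z\<in>n - {x}. E v z \<and> z \<notin> l} \<le> q" using tau[OF vV nL(1) vn] by simp
        qed
        also have "\<dots> \<le> (s - 1) * q" using diff_le_mono[OF on_card[OF x], of 1] l by simp
        finally show ?thesis by simp
      qed
      have "card ?A \<le> (q + 1) * ((s - 1) * q)"
        using order_trans[OF AZ mult_le_mono2[OF cZ]] by (simp only: mult_1)
      then have "real (card ?A) \<le> real ((q + 1) * ((s - 1) * q))" by (simp only: of_nat_le_iff)
      then have A: "real (card m) - 1 \<le> (real q + 1) * ((real s - 1) * real q)"
        using card_minus[OF m] s2 by (simp add: of_nat_diff distrib_right)
      define t where "t = real s - real q"
      have "(real q ^ 3 + real q ^ 2 + real q - 1) * 1 \<le> (real q ^ 3 + real q ^ 2 + real q - 1) * t"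
        using s_minus_q q_pow qr unfolding t_def by (intro mult_left_mono) linarith+
      moreover have "real q ^ 3 - real q \<le> (real q ^ 3 + real q ^ 2 + real q - 1) * 1" using q_pow qr by argo
      ultimately have "real q ^ 3 - real q \<le> (real q ^ 3 + real q ^ 2 + real q - 1) * t" by linarith
      moreover have "(real q ^ 3 + 2 * real q ^ 2 + 2 * real q - 1) * t < real (card m) - 1"
        using size_gt'[OF mL(1)] unfolding t_def by simp
      moreover have "(real q + 1) * ((real s - 1) * real q) = (real q ^ 2 + real q) * t + real q ^ 3 - real q"
        unfolding t_def by (simp add: algebra_simps power2_eq_square power3_eq_cube)
      ultimately show False using A by (simp add: algebra_simps)
    qed
  qed
qed

section \<open>Lines within distance three: the planes\<close>

lemma c4_eq: assumes "D \<ge> 4"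
  shows "real (cs 4) = (real q + 1) * (real q ^ 2 + 1) * (1 + \<alpha> * (real q ^ 2 + real q + 1))"
proof -
  have "Suc 3 = 4" by simp
  then show ?thesis using cs_eq[of 3] assms gnum_4[of q] gnum_3[of q]
    by (simp add: algebra_simps)
qed

text \<open>Otherwise \<open>d u w = 4\<close> with every point of \<open>a\<close> midway. The
  common neighbours of \<open>w\<close> and a point of \<open>a\<close> are then among the
  \<open>c_4\<close> neighbours of \<open>w\<close> at distance three from \<open>u\<close>, each of
  which has at most \<open>q + 1\<close> neighbours on \<open>a\<close>; that makes \<open>a\<close>
  too short.\<close>

lemma near_near_d3: fixes u w :: 'a assumes V: "u \<in> V" "w \<in> V" and a: "a \<in> L" and n: "near w a" "near u a"
  shows "d u w \<le> 3"
proof (rule ccontr)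
  assume "\<not> d u w \<le> 3"
  then have d4: "d u w \<ge> 4" by simp
  have dd: "d u v = 2 \<and> d w v = 2 \<and> d u w = 4" if "v \<in> a" for v
  proof -
    have "v \<in> V" using that L_V a by blast
    then have "d u w \<le> d u v + d w v" using d_tri[of u v w] d_sym[of v w] V by simp
    moreover have "d u v \<le> 2" "d w v \<le> 2" using n that by (auto simp: near_def)
    ultimately show ?thesis using d4 by linarith
  qed
  have "a \<noteq> {}" using size_big[OF a] by auto
  then have uw: "d u w = 4" using dd by blast
  have D4: "D \<ge> 4" using d_le_D[OF V] uw by simp
  let ?Z = "{z. E w z \<and> d u z = 3}"
  have Z: "card ?Z = cs 4" using card_c[OF V, of 3] uw by simp
  have "cs 2 * card a \<le> (q + 1) * card ?Z"
  proof (rule double_count[where R = E])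
    show "finite a" using L_fin a by blast
  next
    fix v assume v: "v \<in> a"
    have vV: "v \<in> V" using v a L_V by blast
    have "{z. E w z \<and> E v z} \<subseteq> {z\<in>?Z. E v z}"
    proof
      fix z assume z: "z \<in> {z. E w z \<and> E v z}"
      then have "d u z \<le> Suc (d u v)" "d u w \<le> Suc (d u z)" using d_tri_E[OF _ V(1)] E_sym by blast+
      then show "z \<in> {z\<in>?Z. E v z}" using z dd[OF v] by auto
    qed
    then have "card {z. E w z \<and> E v z} \<le> card {z\<in>?Z. E v z}" by (intro card_mono) auto
    then show "cs 2 \<le> card {z\<in>?Z. E v z}" using common_nb[OF V(2) vV] dd[OF v] by simp
  next
    fix z assume z: "z \<in> ?Z"
    then have "z \<notin> a" using dd by fastforce
    then have "card {y\<in>a. E z y} \<le> q + 1" using tau z a E_V by blast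
    moreover have "{y\<in>a. E y z} = {y\<in>a. E z y}" using E_commute by blast
    ultimately show "card {y\<in>a. E y z} \<le> q + 1" by simp
  qed simp
  then have "real (cs 2 * card a) \<le> real ((q + 1) * cs 4)" unfolding Z by (simp only: of_nat_le_iff)
  then have "real (cs 2) * real (card a) \<le> (real q + 1) * real (cs 4)"
    by (simp only: of_nat_mult of_nat_add of_nat_1)
  then have "(real q + 1) * ((1 + \<alpha>) * real (card a))
      \<le> (real q + 1) * ((real q + 1) * (real q ^ 2 + 1) * (1 + \<alpha> * (real q ^ 2 + real q + 1)))"
    by (simp only: c2_eq c4_eq[OF D4] mult.assoc)
  then have "(1 + \<alpha>) * real (card a) \<le> (real q + 1) * (real q ^ 2 + 1) * (1 + \<alpha> * (real q ^ 2 + real q + 1))"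
    by (simp add: mult_le_cancel_left_pos)
  also have "\<dots> \<le> (real q + 1) * (real q ^ 2 + 1) * ((1 + \<alpha>) * (real q ^ 2 + 1))"
  proof (intro mult_left_mono)
    have "0 \<le> real q * (real q - \<alpha>)" using \<alpha>_le by simp
    then show "1 + \<alpha> * (real q ^ 2 + real q + 1) \<le> (1 + \<alpha>) * (real q ^ 2 + 1)"
      by (simp add: algebra_simps power2_eq_square)
  qed simp
  finally have "(1 + \<alpha>) * real (card a) \<le> (1 + \<alpha>) * ((real q + 1) * (real q ^ 2 + 1) * (real q ^ 2 + 1))"
    by (simp add: algebra_simps)
  then have "real (card a) \<le> (real q + 1) * (real q ^ 2 + 1) * (real q ^ 2 + 1)"
    using \<alpha>_nonneg by (simp add: mult_le_cancel_left_pos)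
  also have "\<dots> \<le> (real q ^ 3 + 2 * real q ^ 2 + 2 * real q - 1) * (real s - real q)"
  proof (intro mult_mono)
    show "(real q + 1) * (real q ^ 2 + 1) \<le> real q ^ 3 + 2 * real q ^ 2 + 2 * real q - 1"
    proof -
      have "(real q + 1) * (real q ^ 2 + 1) = real q ^ 3 + real q ^ 2 + real q + 1"
        by (simp add: algebra_simps power2_eq_square power3_eq_cube)
      then show ?thesis using q_pow qr by linarith
    qed
    show "0 \<le> real q ^ 3 + 2 * real q ^ 2 + 2 * real q - 1" using q_pow qr by linarith
  qed (use s_minus_q in auto)
  finally show False using size_gt'[OF a] by simp
qed

definition Gs :: "'a \<Rightarrow> 'a \<Rightarrow> 'a set set" where "Gs x w = {l\<in>on x. \<forall>z\<in>l. d w z \<le> 3}"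

text \<open>The bound is the size of a projective plane of order \<open>q\<close>. One line more
  would exceed the number of neighbours of \<open>x\<close> within distance three of
  \<open>w\<close>.\<close>

lemma Gs_card: assumes "x \<in> V" "w \<in> V" "d x w = 3" shows "card (Gs x w) \<le> 1 + q * (q + 1)"
proof (rule ccontr)
  have wx: "d w x = 3" using assms d_sym by metis
  have q3: "qn 3 = real q ^ 2 + real q + 1" by (simp add: gnum_3)
  assume "\<not> card (Gs x w) \<le> 1 + q * (q + 1)"
  then have "real (q ^ 2 + q + 2) \<le> real (card (Gs x w))"
    by (simp only: of_nat_le_iff power2_eq_square) simp
  then have "(real q ^ 2 + real q + 2) * X \<le> real (card (Gs x w)) * X"
    using X_pos by (intro mult_right_mono) auto
  also have "\<dots> \<le> qn (d w x) * (\<beta> + \<alpha> * (r - qn (d w x)))"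
    using assms wx by (intro card_lines_within) (auto simp: Gs_def)
  also have "\<dots> = (real q ^ 2 + real q + 1) * (\<beta> + \<alpha> * (r - (real q ^ 2 + real q + 1)))"
    by (simp only: wx q3)
  also have "\<dots> \<le> (real q ^ 2 + real q + 1) * (X + real q * (real s - 1))"
  proof (rule mult_left_mono)
    have "0 \<le> \<alpha> * (real q ^ 2 + real q)" using \<alpha>_nonneg by simp
    then show "\<beta> + \<alpha> * (r - (real q ^ 2 + real q + 1)) \<le> X + real q * (real s - 1)"
      unfolding X_def by (simp add: algebra_simps)
  qed (simp add: add_nonneg_nonneg)
  finally have A: "X \<le> (real q ^ 2 + real q + 1) * (real q * (real s - 1))" by (simp add: algebra_simps)
  define t where "t = real s - real q"
  have "(real q ^ 2 + real q - 1) * (real q ^ 2 + 1) \<le> (real q ^ 2 + real q - 1) * t"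
    using s_minus_q q_pow qr unfolding t_def by (intro mult_left_mono) linarith+
  moreover have "(real q ^ 2 + real q - 1) * (real q ^ 2 + 1) = real q ^ 4 + real q ^ 3 + real q - 1"
    by (simp add: algebra_simps power2_eq_square power3_eq_cube power4_eq_xxxx)
  moreover have "(real q ^ 2 + real q + 1) * (real q * (real s - 1))
      = (real q ^ 3 + real q ^ 2 + real q) * t + real q ^ 4 - real q"
    unfolding t_def by (simp add: algebra_simps power2_eq_square power3_eq_cube power4_eq_xxxx)
  moreover have "(real q ^ 3 + 2 * real q ^ 2 + 2 * real q - 1) * t < X" using X_gt unfolding t_def .
  ultimately show False using A q_pow qr by (simp add: algebra_simps)
qed

text \<open>The block through two lines. For distinct lines on \<open>x\<close> a suitable
  \<open>y\<close> exists by \<open>apex_exists\<close>, and \<open>Qs_unique\<close> makes the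
  choice immaterial.\<close>

definition J :: "'a \<Rightarrow> 'a set \<Rightarrow> 'a set \<Rightarrow> 'a set set" where
  "J x l m = Qs x (SOME y. y \<in> V \<and> d x y = 2 \<and> l \<in> Qs x y \<and> m \<in> Qs x y)"

lemma J_eq_Qs: assumes "x \<in> V" "y \<in> V" "d x y = 2" "l \<in> Qs x y" "m \<in> Qs x y" "l \<noteq> m"
  shows "J x l m = Qs x y"
proof -
  let ?P = "\<lambda>y. y \<in> V \<and> d x y = 2 \<and> l \<in> Qs x y \<and> m \<in> Qs x y"
  have "?P (SOME y. ?P y)" using assms by (intro someI[of ?P y]) auto
  then show ?thesis unfolding J_def using Qs_unique[OF assms(1) _ assms(2) _ assms(3)] assms by blast
qed

lemma J_ex: assumes "x \<in> V" "l \<in> on x" "m \<in> on x" "l \<noteq> m"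
  obtains y where "y \<in> V" "d x y = 2" "l \<in> Qs x y" "m \<in> Qs x y" "J x l m = Qs x y"
proof -
  obtain y v v' where y: "y \<in> V" "d x y = 2" "v \<in> l" "v' \<in> m" "E y v" "E y v'"
    using apex_exists[OF assms] by blast
  then have "l \<in> Qs x y" "m \<in> Qs x y" using Qs_I near_nb assms onD by metis+
  then show ?thesis using that y J_eq_Qs assms by blast
qed

lemma J_eq_Cl: assumes "x \<in> V" "a \<in> L" "near x a" "x \<notin> a" "l \<in> Cl x a" "m \<in> Cl x a" "l \<noteq> m"
  shows "J x l m = Cl x a"
proof -
  obtain y where "y \<in> a" "d x y = 2" "Cl x a = Qs x y" using Cl_point[OF assms(1-4)] by blast
  then show ?thesis using J_eq_Qs[OF assms(1), of y] L_V assms by metis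
qed

lemma linear_space_on: assumes x: "x \<in> V" shows "linear_space (on x) (J x) q"
proof
  show "finite (on x)" by simp
next
  fix a b assume ab: "a \<in> on x" "b \<in> on x" "a \<noteq> b"
  obtain y where y: "y \<in> V" "d x y = 2" "a \<in> Qs x y" "b \<in> Qs x y" "J x a b = Qs x y"
    using J_ex[OF x ab] by blast
  show "a \<in> J x a b \<and> b \<in> J x a b \<and> J x a b \<subseteq> on x" using y by (auto simp: Qs_def)
  show "card (J x a b) = q + 1" using y Qs_card[OF x] by simp
  fix c e assume "c \<in> J x a b" "e \<in> J x a b" "c \<noteq> e"
  then show "J x c e = J x a b" using J_eq_Qs[OF x y(1,2)] y by simp
qed

text \<open>The blocks \<open>Cl x a\<close> with \<open>a \<in> Qs v w\<close> are \<open>q + 1\<close> distinct blocks through \<open>l\<close> inside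
  \<open>Gs x w\<close>; together they already have \<open>q\<^sup>2 + q + 1\<close> elements.\<close>

lemma Gs_closed:
  assumes V: "x \<in> V" "w \<in> V" and xw: "d x w = 3" and l: "l \<in> on x" and v: "v \<in> l" "d v w = 2"
    and g: "g \<in> Gs x w" "g \<noteq> l"
  shows "l \<in> Gs x w" "J x l g \<subseteq> Gs x w"
proof -
  have lL: "l \<in> L" "x \<in> l" using l onD by auto
  have vV: "v \<in> V" using lL v L_V by blast
  have wv: "d w v = 2" and wx: "d w x = 3" using d_sym vV V v xw by metis+
  show lG: "l \<in> Gs x w" using line_d[OF lL(1) v(1) _ V(2)] wv l by (fastforce simp: Gs_def)
  have vx: "v \<noteq> x" using v xw by auto
  have lQ: "l \<notin> Qs v w" using lL wx Qs_D(3)[of l v w] unfolding near_def by fastforce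
  have a: "a \<in> L" "v \<in> a" "near w a" "x \<notin> a" "near x a" "l \<in> Cl x a" "Cl x a \<subseteq> Gs x w"
    if a: "a \<in> Qs v w" for a
  proof -
    show aL: "a \<in> L" "v \<in> a" "near w a" using a Qs_D by auto
    have "a \<noteq> l" using a lQ by blast
    then show xa: "x \<notin> a" using two_points[OF aL(1) lL(1) _ aL(2) lL(2) v(1)] vx by blast
    show na: "near x a" using line_nb[OF aL(1,2) lL(1) v(1) lL(2)] vx by blast
    show "l \<in> Cl x a" using Cl_I[OF lL] close_meet[OF lL(1) aL(1) v(1) aL(2)] by blast
    show "Cl x a \<subseteq> Gs x w"
    proof
      fix f assume f: "f \<in> Cl x a"
      have "d w z \<le> 3" if "z \<in> f" for z
        using near_near_d3[OF V(2) _ aL(1) _ aL(3)] f that Cl_D L_V unfolding close_def by blast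
      then show "f \<in> Gs x w" using f by (auto simp: Gs_def Cl_def)
    qed
  qed
  \<comment> \<open>A second common line \<open>h\<close> would put \<open>a1\<close> and
    \<open>a2\<close> into \<open>Cl v h\<close>, which would then be the block
    \<open>Qs v w\<close>. But \<open>Cl v h\<close> contains \<open>l\<close>, and
    \<open>Qs v w\<close> does not, since \<open>x\<close> is at distance three from
    \<open>w\<close>.\<close>
  have disj: "h = l" if "a1 \<in> Qs v w" "a2 \<in> Qs v w" "a1 \<noteq> a2" "h \<in> Cl x a1" "h \<in> Cl x a2" for a1 a2 h
  proof (rule ccontr)
    assume hl: "h \<noteq> l"
    have hL: "h \<in> L" "x \<in> h" using that Cl_D by auto
    have vh: "v \<notin> h" using two_points[OF hL(1) lL(1) hL(2) _ lL(2) v(1)] vx hl by blast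
    have nh: "near v h" using line_nb[OF hL lL v(1) vx] .
    have C: "a1 \<in> Cl v h" "a2 \<in> Cl v h"
      using Cl_I[OF a(1,2)[OF that(1)]] close_sym[OF a(1)[OF that(1)] hL(1)]
        Cl_I[OF a(1,2)[OF that(2)]] close_sym[OF a(1)[OF that(2)] hL(1)]
        close_sym[OF hL(1) a(1)[OF that(1)] Cl_D(3)[OF that(4)]]
        close_sym[OF hL(1) a(1)[OF that(2)] Cl_D(3)[OF that(5)]] by simp_all
    have "J v a1 a2 = Cl v h" using J_eq_Cl[OF vV hL(1) nh vh C that(3)] .
    moreover have "J v a1 a2 = Qs v w" using J_eq_Qs[OF vV V(2) v(2)] that by blast
    moreover have "l \<in> Cl v h" using Cl_I[OF lL(1) v(1)] close_meet[OF lL(1) hL(1) lL(2) hL(2)] by blast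
    ultimately show False using lQ by simp
  qed
  let ?U = "\<Union>a\<in>Qs v w. Cl x a - {l}"
  have "card ?U = (\<Sum>a\<in>Qs v w. card (Cl x a - {l}))"
    using disj by (intro card_UN_disjoint) auto
  also have "\<dots> = (\<Sum>a\<in>Qs v w. q)" using a Cl_card[OF V(1)] by (intro sum.cong) auto
  also have "\<dots> = q * (q + 1)" using Qs_card[OF vV V(2) v(2)] by simp
  finally have cU: "card (insert l ?U) = 1 + q * (q + 1)" by (simp add: card.insert_remove)
  have "insert l ?U \<subseteq> Gs x w" using a(7) lG by blast
  moreover have "finite (Gs x w)" by (simp add: Gs_def)
  ultimately have "insert l ?U = Gs x w" using Gs_card[OF V xw] cU by (intro card_seteq) auto
  then obtain a0 where a0: "a0 \<in> Qs v w" "g \<in> Cl x a0" using g by blast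
  then have "J x l g = Cl x a0" using J_eq_Cl[OF V(1)] a[OF a0(1)] g(2) by metis
  then show "J x l g \<subseteq> Gs x w" using a(7)[OF a0(1)] by simp
qed

text \<open>Take a line \<open>a \<noteq> l\<close> on \<open>v\<close> close to \<open>h\<close>, a
  line \<open>f\<close> on \<open>y\<close> close to \<open>a\<close> but not near \<open>x\<close>,
  and \<open>w\<close> on \<open>f\<close> at distance three from \<open>x\<close>. Both
  \<open>w\<close> and all points of \<open>h\<close> are near \<open>a\<close>, which gives
  \<open>h \<in> Gs x w\<close>; and \<open>y\<close> links \<open>v\<close> and \<open>v'\<close>
  to \<open>w\<close>.\<close>

lemma plane_point:
  assumes x: "x \<in> V" and l: "l \<in> on x" and m: "m \<in> on x" and h: "h \<in> on x"
    and lm: "l \<noteq> m" and hJ: "h \<notin> J x l m"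
  obtains w v v' where "w \<in> V" "d x w = 3" "v \<in> l" "d v w = 2" "v' \<in> m" "d v' w = 2" "h \<in> Gs x w"
proof -
  obtain y v v' where y: "y \<in> V" "d x y = 2" and v: "v \<in> l" "E y v" and v': "v' \<in> m" "E y v'"
    using apex_exists[OF x l m lm] by blast
  have lL: "l \<in> L" "x \<in> l" and mL: "m \<in> L" "x \<in> m" and hL: "h \<in> L" "x \<in> h" using l m h onD by auto
  have lQ: "l \<in> Qs x y" "m \<in> Qs x y" using Qs_I near_nb lL mL v v' by blast+
  have "h \<notin> Qs x y" using hJ J_eq_Qs[OF x y lQ lm] by simp
  then have nyh: "\<not> near y h" and hl: "h \<noteq> l" using hL Qs_I lQ by blast+
  have vV: "v \<in> V" "v' \<in> V" using E_V v v' by auto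
  have vx: "v \<noteq> x" "v' \<noteq> x" using v v' d2_not_E y by blast+
  have vh: "v \<notin> h" using two_points[OF hL(1) lL(1) hL(2) _ lL(2) v(1)] vx hl by blast
  have nvh: "near v h" using line_nb[OF hL lL v(1) vx(1)] .
  have "l \<in> Cl v h" using Cl_I[OF lL(1) v(1)] close_meet[OF lL(1) hL(1) lL(2) hL(2)] by blast
  have cvh: "card (Cl v h) = q + 1" using Cl_card[OF vV(1) hL(1) nvh vh] .
  then have "\<not> Cl v h \<subseteq> {l}" using q2 card_mono[of "{l}" "Cl v h"] by auto
  then obtain a where a: "a \<in> Cl v h" "a \<noteq> l" by blast
  have aL: "a \<in> L" "v \<in> a" "close a h" using a Cl_D by auto
  have ya: "y \<notin> a" using aL nyh by (auto simp: close_def)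
  have nya: "near y a" using near_nb[OF aL(1,2) v(2)] .
  obtain e where e: "e \<in> L" "y \<in> e" "v \<in> e" using edge_line v by blast
  have "near x e" using near_nb[OF e(1,3)] L_E[OF lL(1,2) v(1)] vx by blast
  then have eQ: "e \<in> Qs y x" using Qs_I e by blast
  have yx: "d y x = 2" using d2_sym x y by blast
  \<comment> \<open>If these blocks agreed, then for \<open>f \<noteq> e\<close> in
    \<open>Qs y x\<close> the block \<open>Cl v f\<close> would contain \<open>a\<close>,
    \<open>l\<close> and \<open>e\<close>, and so equal \<open>Cl v h\<close>. But \<open>e\<close>
    contains \<open>y\<close>, which is not near \<open>h\<close>.\<close>
  have "\<not> Cl y a \<subseteq> Qs y x"
  proof
    assume "Cl y a \<subseteq> Qs y x"
    then have eq: "Cl y a = Qs y x"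
      using Cl_card[OF y(1) aL(1) nya ya] Qs_card[OF y(1) x yx] by (intro card_subset_eq) auto
    have "\<not> Qs y x \<subseteq> {e}" using q2 card_mono[of "{e}" "Qs y x"] Qs_card[OF y(1) x yx] by auto
    then obtain f where f: "f \<in> Qs y x" "f \<noteq> e" by blast
    have fL: "f \<in> L" "y \<in> f" using f Qs_D by auto
    have yv: "v \<noteq> y" using v by auto
    have vf: "v \<notin> f" using two_points[OF fL(1) e(1) fL(2) _ e(2,3)] yv f(2) by blast
    have nvf: "near v f" using line_nb[OF fL e(1,2,3) yv] .
    have "close f a" using f eq Cl_D(3) by blast
    then have 1: "a \<in> Cl v f" using Cl_I[OF aL(1,2)] close_sym[OF fL(1) aL(1)] by blast
    have 2: "l \<in> Cl v f" using Cl_I[OF lL(1) v(1)] Qs_close[OF x y(2) lQ(1) f(1)] by blast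
    have 3: "e \<in> Cl v f" using Cl_I[OF e(1,3)] close_meet[OF e(1) fL(1) e(2) fL(2)] by blast
    have "J v a l = Cl v f" using J_eq_Cl[OF vV(1) fL(1) nvf vf 1 2 a(2)] .
    moreover have "J v a l = Cl v h" using J_eq_Cl[OF vV(1) hL(1) nvh vh a(1) \<open>l \<in> Cl v h\<close> a(2)] .
    ultimately have "close e h" using 3 Cl_D(3) by blast
    then show False using nyh e(2) by (auto simp: close_def)
  qed
  then obtain f where f: "f \<in> Cl y a" "f \<notin> Qs y x" by blast
  have fL: "f \<in> L" "y \<in> f" "close f a" using f Cl_D by auto
  then have "\<not> near x f" using f(2) Qs_I by blast
  then obtain w where w: "w \<in> f" "d x w > 2" by (auto simp: near_def)
  have wV: "w \<in> V" using L_V fL w by blast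
  have xw: "d x w = 3" using line_d[OF fL(1,2) w(1) x] y w by simp
  have dv: "d u w = 2" if u: "u \<in> V" "E y u" "E x u" for u
  proof -
    have "d u w \<le> Suc (d u y)" using line_d[OF fL(1,2) w(1) u(1)] .
    moreover have "d u y = Suc 0" using d_E E_sym u by blast
    moreover have "d x w \<le> Suc (d u w)" using d_tri_E'[OF u(3) wV] .
    ultimately show ?thesis using xw by simp
  qed
  have "E x v" "E x v'" using L_E lL mL v v' vx by blast+
  then have "d v w = 2" "d v' w = 2" using dv vV v v' by blast+
  moreover have "h \<in> Gs x w"
  proof -
    have "d w u \<le> 3" if u: "u \<in> h" for u
    proof -
      have "near u a" using close_sym[OF aL(1) hL(1) aL(3)] u by (auto simp: close_def)
      moreover have "near w a" using fL(3) w by (auto simp: close_def)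
      ultimately show ?thesis using near_near_d3[OF wV _ aL(1)] L_V[OF hL(1) u] by blast
    qed
    then show ?thesis using h by (auto simp: Gs_def)
  qed
  ultimately show ?thesis using that[of w v v'] wV xw v v' by blast
qed

text \<open>All the lines lie in one plane \<open>Gs x w\<close> that is closed under joins with
  \<open>a\<close> and with \<open>c'\<close>. The cone from \<open>a\<close> over the block of
  \<open>c'\<close> and \<open>a'\<close> already has the maximal size of the plane, so it contains
  \<open>c\<close>; hence a line of that block lies in the block of \<open>a\<close> and
  \<open>c\<close>.\<close>

lemma veblen_space_on: assumes x: "x \<in> V" shows "veblen_space (on x) (J x) q"
proof -
  interpret linear_space "on x" "J x" q using linear_space_on[OF x] .
  show ?thesis
  proof
    fix h a c a' c' assume N: "h \<in> on x" "a \<in> on x" "c \<in> on x" and ne: "a \<noteq> h" "c \<noteq> h" "c \<notin> J x h a"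
      and a': "a' \<in> J x h a" "a' \<noteq> h" and c': "c' \<in> J x h c" "c' \<noteq> h"
    have N': "a' \<in> on x" "c' \<in> on x" using J_in[of h a] J_in[of h c] N ne a' c' by blast+
    have Ja': "J x h a' = J x h a" and Jc': "J x h c' = J x h c" using J_shift N ne a' c' by metis+
    have c'a: "c' \<notin> J x h a"
    proof
      assume "c' \<in> J x h a"
      then have "J x h c' = J x h a" using J_shift N ne c' by metis
      then show False using Jc' J_in[of h c] N ne by metis
    qed
    have aJ: "a \<in> J x h a" using J_in N ne by metis
    have ac: "a \<noteq> c" "a \<noteq> c'" "a' \<noteq> c'" using ne aJ c'a a' by blast+
    show "J x a c \<inter> J x a' c' \<noteq> {}"
    proof (cases "a = a'")
      case True
      then show ?thesis using J_in[of a c] J_in[of a c'] N N' ac by blast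
    next
      case False
      have "h \<notin> J x a c'"
      proof
        assume "h \<in> J x a c'"
        then have "J x h a = J x a c'" using J_eq[of a c' h a] J_in[of a c'] N N' ac ne by blast
        then show False using c'a J_in[of a c'] N N' ac by blast
      qed
      then obtain w v v' where w: "w \<in> V" "d x w = 3" and v: "v \<in> a" "d v w = 2"
        and v': "v' \<in> c'" "d v' w = 2" and hG: "h \<in> Gs x w"
        using plane_point[OF x N(2) N'(2) N(1) ac(2)] by blast
      note Ga = Gs_closed[OF x w N(2) v] and Gc = Gs_closed[OF x w N'(2) v']
      have "J x a h \<subseteq> Gs x w" "J x c' h \<subseteq> Gs x w" using Ga(2)[OF hG] Gc(2)[OF hG] ne c' by blast+
      moreover have "J x a h = J x h a" "J x c' h = J x h c" using J_commute N N' ne c' Jc' by metis+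
      ultimately have a'G: "a' \<in> Gs x w" and cG: "c \<in> Gs x w"
        using a' J_in[of h c] N ne by blast+
      have S: "J x c' a' \<subseteq> Gs x w" using Gc(2)[OF a'G] ac by blast
      let ?S = "J x c' a'"
      have sub: "subsp ?S" unfolding subsp_def
        using J_in[of c' a'] J_eq[of c' a'] N' ac by blast
      have ne': "?S \<noteq> {}" using J_in[of c' a'] N' ac by blast
      have aS: "a \<notin> ?S"
      proof
        assume "a \<in> ?S"
        then have "J x a a' = ?S" using J_eq[of c' a' a a'] J_in[of c' a'] N' ac False by metis
        moreover have "J x a a' = J x h a" using J_eq[of h a a a'] N ne aJ a' False by metis
        ultimately show False using c'a J_in[of c' a'] N' ac by metis
      qed
      have "cone a ?S \<subseteq> Gs x w" unfolding cone_def using Ga(2) S aS by blast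
      moreover have "card (cone a ?S) = 1 + q * (q + 1)"
        using cone_card[OF sub ne' N(2) aS] J_card[of c' a'] N' ac by metis
      moreover have "finite (Gs x w)" by (simp add: Gs_def)
      ultimately have "cone a ?S = Gs x w" using Gs_card[OF x w] by (intro card_seteq) auto
      then obtain z where z: "z \<in> ?S" "c \<in> J x a z" using cG unfolding cone_def by blast
      have zN: "z \<in> on x" "z \<noteq> a" using z S aS by (auto simp: Gs_def)
      have "J x a c = J x a z" using J_shift[of a z c] N zN z ac by metis
      then have "z \<in> J x a c" using J_in[of a z] N zN by metis
      moreover have "z \<in> J x a' c'" using z J_commute[of c' a'] N' ac by metis
      ultimately show ?thesis by blast
    qed
  qed
qed

section \<open>The number of lines on a vertex and their common size\<close>

lemma on_card_eq: assumes x: "x \<in> V" shows "card (on x) = gnum q D"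
proof -
  interpret veblen_space "on x" "J x" q using veblen_space_on[OF x] .
  have lo: "gnum q D \<le> card (on x)" using on_ge_r[OF x] by simp
  have "on x \<noteq> {}" using on_ge_r[OF x] r_pos by auto
  then obtain i where i: "card (on x) = gnum q i" using card_gnum by blast
  \<comment> \<open>The next Gaussian number is \<open>1 + q r\<close>. So many lines with
    \<open>X\<close> further points each would exceed the valency \<open>r * \<beta>\<close>,
    because \<beta> is at most \<open>X + q (s - 1)\<close> and \<open>X\<close> is far larger than
    \<open>s\<close>.\<close>
  have "card (on x) < gnum q (Suc D)"
  proof (rule ccontr)
    assume "\<not> card (on x) < gnum q (Suc D)"
    then have "real (1 + q * gnum q D) \<le> real (card (on x))"
      by (simp only: of_nat_le_iff not_less gnum_Suc)
    then have "(1 + real q * r) * X \<le> real (card (on x)) * X"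
      using X_pos by (intro mult_right_mono) auto
    also have "\<dots> = (\<Sum>l\<in>on x. X)" by simp
    also have "\<dots> \<le> (\<Sum>l\<in>on x. real (card l) - 1)" using X_size onD by (intro sum_mono) blast
    also have "\<dots> = r * \<beta>" using valency_lines[OF x] by simp
    also have "\<dots> \<le> r * (X + real q * (real s - 1))"
    proof (rule mult_left_mono)
      have "1 \<le> r" using r_pos by simp
      then have "0 \<le> \<alpha> * (r - 1)" using \<alpha>_nonneg by simp
      then show "\<beta> \<le> X + real q * (real s - 1)" unfolding X_def by simp
    qed simp
    finally have "r * ((real q - 1) * X) \<le> r * (real q * (real s - 1))"
      using X_pos by (simp add: algebra_simps)
    then have A: "(real q - 1) * X \<le> real q * (real s - 1)"
      using r_pos by (simp add: mult_le_cancel_left_pos)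
    have "1 * X \<le> (real q - 1) * X" using qr X_pos by (intro mult_right_mono) auto
    define t where "t = real s - real q"
    have t: "real q ^ 2 + 1 \<le> t" using s_minus_q unfolding t_def .
    have "(real q ^ 3 + 2 * real q ^ 2 + real q - 1) * t \<ge> 1 * t"
      using t q_pow qr by (intro mult_right_mono) linarith+
    moreover have "real q * (real s - 1) = real q * t + real q ^ 2 - real q"
      unfolding t_def by (simp add: algebra_simps power2_eq_square)
    moreover have "(real q ^ 3 + 2 * real q ^ 2 + 2 * real q - 1) * t < X" using X_gt unfolding t_def .
    ultimately show False using A \<open>1 * X \<le> (real q - 1) * X\<close> t qr by (simp add: algebra_simps)
  qed
  then have "\<not> Suc D \<le> i" using i gnum_mono[of "Suc D" i q] by auto
  then have "gnum q i \<le> gnum q D" by (intro gnum_mono) simp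
  then show ?thesis using i lo by simp
qed

lemma card_line: assumes "l \<in> L" shows "real (card l) = 1 + \<beta>"
proof -
  have "l \<noteq> {}" using size_big[OF assms] by auto
  then obtain x where x: "x \<in> l" by blast
  then have xV: "x \<in> V" and lon: "l \<in> on x" using L_V assms onI by auto
  have nn: "\<And>m. m \<in> on x \<Longrightarrow> 0 \<le> \<beta> - (real (card m) - 1)"
    using clique_bound L_clique onD by fastforce
  have "(\<Sum>m\<in>on x. \<beta> - (real (card m) - 1)) = 0"
    using valency_lines[OF xV] on_card_eq[OF xV] by (simp add: sum_subtractf)
  then have "\<beta> - (real (card l) - 1) = 0" using sum_nonneg_eq_0_iff[of "on x" "\<lambda>m. \<beta> - (real (card m) - 1)"] nn lon by simp
  then show ?thesis by simp
qed

end

section \<open>Geometricity\<close>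

context line_geometry
begin

lemma eigenvalue_ge: assumes "eigfun \<theta> g" "\<exists>x\<in>V. g x \<noteq> 0" shows "- r \<le> \<theta>"
proof -
  \<comment> \<open>Over the lines on \<open>x\<close>, the vertex \<open>x\<close> is summed
    \<open>r\<close> times and each neighbour once.\<close>
  have star: "(\<Sum>l\<in>on x. \<Sum>y\<in>l. g y) = (r + \<theta>) * g x" if x: "x \<in> V" for x
  proof -
    have "(\<Sum>l\<in>on x. \<Sum>y\<in>l. g y) = (\<Sum>l\<in>on x. g x + (\<Sum>y\<in>l - {x}. g y))"
    proof (rule sum.cong[OF refl])
      fix l assume "l \<in> on x"
      then have "finite l" "x \<in> l" using L_fin onD by auto
      then show "(\<Sum>y\<in>l. g y) = g x + (\<Sum>y\<in>l - {x}. g y)" by (rule sum.remove)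
    qed
    also have "\<dots> = r * g x + (\<Sum>l\<in>on x. \<Sum>y\<in>l - {x}. g y)"
      using on_card_eq[OF x] by (simp add: sum.distrib)
    also have "(\<Sum>l\<in>on x. \<Sum>y\<in>l - {x}. g y) = (\<Sum>y\<in>(\<Union>l\<in>on x. l - {x}). g y)"
    proof (rule sum.UNION_disjoint[symmetric])
      show "\<forall>l\<in>on x. \<forall>m\<in>on x. l \<noteq> m \<longrightarrow> (l - {x}) \<inter> (m - {x}) = {}"
        using two_points by (fastforce simp: on_def)
    qed (use L_fin onD in auto)
    also have "(\<Union>l\<in>on x. l - {x}) = {y. E x y}"
    proof (intro equalityI subsetI)
      fix y assume "y \<in> {y. E x y}"
      then have xy: "E x y" by simp
      then obtain l where "l \<in> L" "x \<in> l" "y \<in> l" using edge_line by blast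
      then show "y \<in> (\<Union>l\<in>on x. l - {x})" using xy onI by auto
    qed (use L_E in \<open>auto simp: on_def\<close>)
    also have "(\<Sum>y\<in>{y. E x y}. g y) = \<theta> * g x" using assms(1) x by (simp add: eigfun_def)
    finally show ?thesis by (simp add: algebra_simps)
  qed
  have "0 \<le> (\<Sum>l\<in>L. (\<Sum>x\<in>l. g x) * (\<Sum>y\<in>l. g y))" by (rule sum_nonneg) simp
  also have "\<dots> = (\<Sum>l\<in>L. \<Sum>x\<in>{x\<in>V. x \<in> l}. g x * (\<Sum>y\<in>l. g y))"
  proof (rule sum.cong[OF refl])
    fix l assume "l \<in> L"
    then have "{x\<in>V. x \<in> l} = l" using L_V by blast
    then show "(\<Sum>x\<in>l. g x) * (\<Sum>y\<in>l. g y) = (\<Sum>x\<in>{x\<in>V. x \<in> l}. g x * (\<Sum>y\<in>l. g y))"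
      by (simp add: sum_distrib_right)
  qed
  also have "\<dots> = (\<Sum>x\<in>V. \<Sum>l\<in>{l\<in>L. x \<in> l}. g x * (\<Sum>y\<in>l. g y))"
    by (rule sum.swap_restrict) (simp_all add: L_finite)
  also have "\<dots> = (\<Sum>x\<in>V. g x * ((r + \<theta>) * g x))"
    using star by (intro sum.cong) (auto simp: on_def sum_distrib_left[symmetric])
  also have "\<dots> = (r + \<theta>) * (\<Sum>x\<in>V. (g x)\<^sup>2)"
    by (simp add: sum_distrib_left power2_eq_square algebra_simps)
  finally have "0 \<le> (r + \<theta>) * (\<Sum>x\<in>V. (g x)\<^sup>2)" .
  moreover have "0 < (\<Sum>x\<in>V. (g x)\<^sup>2)"
  proof -
    obtain x where "x \<in> V" "g x \<noteq> 0" using assms(2) by blast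
    then show ?thesis by (intro sum_pos2[of _ x]) auto
  qed
  ultimately show ?thesis by (simp add: zero_le_mult_iff)
qed

lemma theta_min_eq: "theta_min V E = - r"
  unfolding theta_min_def
proof (rule Min_eqI)
  show "finite {\<theta>. adj_eigenvalue V E \<theta>}" using finite_eigenvalues[OF D0] .
  show "- r \<in> {\<theta>. adj_eigenvalue V E \<theta>}" using adj_eigenvalue_min by simp
  fix \<theta> assume "\<theta> \<in> {\<theta>. adj_eigenvalue V E \<theta>}"
  then show "- r \<le> \<theta>" using eigenvalue_ge by (auto simp: adj_eigenvalue_eigfun)
qed

lemma geometric_lines: "geometric V E (bs 0)"
  unfolding geometric_def
proof (intro exI[of _ L] conjI ballI impI)
  fix C assume C: "C \<in> L"
  have "real (bs 0) / r = \<beta>" using k_eq r_pos by simp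
  then show "delsarte_clique V E (bs 0) C"
    unfolding delsarte_clique_def theta_min_eq using L_clique[OF C] card_line[OF C] by simp
next
  fix x y assume "E x y"
  then show "\<exists>!C. C \<in> L \<and> x \<in> C \<and> y \<in> C" by (rule L_unique)
qed

end

theorem theorem15:
  fixes V :: "'a set" and E :: "'a \<Rightarrow> 'a \<Rightarrow> bool"
    and D :: nat and bs cs :: "nat \<Rightarrow> nat" and b :: int and \<alpha> \<beta> :: real and s :: nat
  assumes drg: "distance_regular V E D bs cs"
    and cp: "classical_parameters D bs cs b \<alpha> \<beta>"
    and b2: "b \<ge> 2" and D3: "D \<ge> 3" and s1: "s \<ge> 1"
    and spls: "SPLS V E (int (bs 0) - int (bs 1) - int (cs 1)) (cs 2) s"
    and h1: "\<beta> > (real_of_int b + 2) * (real_of_int b + 1) * (real s - 1)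
               - (real_of_int b * (real_of_int b + 1) + qnum b D - 1) * \<alpha>"
    and h2: "\<beta> > ((real_of_int b + 1) * (real_of_int b ^ 2 + real_of_int b + 1) - 2)
                 * (real s - real_of_int b)
               - \<alpha> * (real_of_int b + 1) * qnum b D + \<alpha> * (real_of_int b + 1) ^ 2"
    and h3: "\<beta> > ((real_of_int b + 1) * (real_of_int b ^ 2 + real_of_int b + 1) - 2 + real_of_int b)
                 * (real s - real_of_int b)
               - \<alpha> * (qnum b D - 1) + real_of_int b ^ 2 - real_of_int b"
  shows "geometric V E (bs 0)"
proof -
  define q where "q = nat b"
  have q: "b = int q" "q \<ge> 2" using b2 by (auto simp: q_def)
  have qn: "qnum b i = real (gnum q i)" for i using gnum_qnum[OF q(2)] q(1) by simp
  have rq: "real_of_int b = real q" using q(1) by simp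
  interpret classical_drg V E D bs cs q \<alpha> \<beta>
  proof
    fix i
    show "i < D \<Longrightarrow> real (bs i) = (real (gnum q D) - real (gnum q i)) * (\<beta> - \<alpha> * real (gnum q i))"
      using cp D3 unfolding classical_parameters_def qn by simp
    show "Suc i \<le> D \<Longrightarrow> real (cs (Suc i)) = real (gnum q (Suc i)) * (1 + \<alpha> * real (gnum q i))"
    proof -
      assume "Suc i \<le> D"
      moreover have "\<And>j. 1 \<le> j \<Longrightarrow> j \<le> D \<Longrightarrow>
          real (cs j) = real (gnum q j) * (1 + \<alpha> * real (gnum q (j - 1)))"
        using cp unfolding classical_parameters_def qn by blast
      ultimately show ?thesis by fastforce
    qed
  qed (use drg q D3 in auto)
  define a1 where "a1 = int (bs 0) - int (bs 1) - int (cs 1)"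
  define L where "L = spls_lines V E a1 (cs 2) s"
  have a1: "real_of_int a1 = \<beta> + \<alpha> * (r - 1) - 1"
    using bs_eq[of 0] bs_eq[of 1] cs_eq[of 0] D3 by (simp add: a1_def algebra_simps)
  note sp = spls[unfolded SPLS_def Let_def, folded a1_def, folded L_def]
  have s_two: "s \<ge> 2" and lines_le: "\<forall>x\<in>V. \<forall>y\<in>V. x \<noteq> y \<longrightarrow> card {l\<in>L. x \<in> l \<and> y \<in> l} \<le> 1"
    and point_graph: "\<forall>x\<in>V. \<forall>y\<in>V. E x y \<longleftrightarrow> x \<noteq> y \<and> (\<exists>l\<in>L. x \<in> l \<and> y \<in> l)"
    and a1_le: "a1 \<ge> (2 * int s - 1) * (int (cs 2) - 1)"
    and on_le: "\<forall>x\<in>V. card {l\<in>L. x \<in> l} \<le> s"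
    and tau_le: "\<forall>x\<in>V. \<forall>l\<in>L. x \<notin> l \<longrightarrow> card {y\<in>l. E x y} \<le> cs 2"
    using sp by simp_all
  have clq: "\<And>l. l \<in> L \<Longrightarrow> is_clique V E l"
    by (simp add: L_def spls_lines_def maximal_clique_def)
  \<comment> \<open>The bound by 1 on a \<open>card\<close> yields uniqueness only for a finite set
    of lines.\<close>
  then have finL: "finite L" by (intro finite_subset[of L "Pow V"]) (auto simp: is_clique_def)
  interpret line_geometry V E D bs cs q \<alpha> \<beta> L s
  proof
    fix x y assume xy: "E x y"
    then have V: "x \<in> V" "y \<in> V" "x \<noteq> y" using E_V by auto
    then have "card {l\<in>L. x \<in> l \<and> y \<in> l} \<le> Suc 0" using lines_le by simp
    then have "\<And>l m. l \<in> L \<Longrightarrow> m \<in> L \<Longrightarrow> x \<in> l \<Longrightarrow> y \<in> l \<Longrightarrow> x \<in> m \<Longrightarrow> y \<in> m \<Longrightarrow> l = m"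
      using finL by (subst (asm) card_le_Suc0_iff_eq) auto
    then show "\<exists>!l. l \<in> L \<and> x \<in> l \<and> y \<in> l" using point_graph V xy by blast
  next
    fix l assume "l \<in> L"
    then have "int (card l) \<ge> a1 + 2 - (int (cs 2) - 1) * (int s - 1)"
      by (simp add: L_def spls_lines_def)
    then have "real_of_int (a1 + 2 - (int (cs 2) - 1) * (int s - 1)) \<le> real_of_int (int (card l))"
      by (simp only: of_int_le_iff)
    then show "real (card l) \<ge> \<beta> + \<alpha> * (r - 1) + 1 - (real (cs 2) - 1) * (real s - 1)"
      using a1 by simp
  next
    have "real_of_int ((2 * int s - 1) * (int (cs 2) - 1)) \<le> real_of_int a1"
      using a1_le by (simp only: of_int_le_iff)
    then show "\<beta> + \<alpha> * (r - 1) - 1 \<ge> (2 * real s - 1) * (real (cs 2) - 1)" using a1 by simp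
  next
    show "\<beta> > (real q + 2) * (real q + 1) * (real s - 1) - (real q * (real q + 1) + r - 1) * \<alpha>"
      using h1 unfolding rq qn .
    show "\<beta> > ((real q + 1) * (real q ^ 2 + real q + 1) - 2) * (real s - real q)
        - \<alpha> * (real q + 1) * r + \<alpha> * (real q + 1) ^ 2"
      using h2 unfolding rq qn .
    show "\<beta> > ((real q + 1) * (real q ^ 2 + real q + 1) - 2 + real q) * (real s - real q)
        - \<alpha> * (r - 1) + real q ^ 2 - real q"
      using h3 unfolding rq qn .
  qed (use clq s_two on_le tau_le in auto)
  show ?thesis by (rule geometric_lines)
qed

end
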